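(* Let $s\geq0$ be real, let $n$ be an integer with $1\leq n\leq 2+2s$, and let $\kappa\geq0$ be real with $\lfloor\kappa\rfloor>2+s-\frac n2$. Let $u$ be the solution of $u_{tt}-\Delta u=0$ in $(0,\infty)\times\mathbb{R}^n$, $(u,u_t)(0,\cdot)=(u_0,u_1)$, where $u_0\in L^2$ and $\nabla^s u_1\in L^2\cap L^{1,\kappa}$. Assume moreover that for multi-indices $\alpha\in\mathbb{N}_0^n$ $$\int_{\mathbb{R}^n}x^\alpha\,\nabla^s u_1(x)\,dx\ \begin{cases}=0&\text{if } |\alpha|<\lfloor\kappa\rfloor-1,\\ \neq0&\text{if } |\alpha|=\lfloor\kappa\rfloor-1.\end{cases}$$ Then there are constants $c,C,T>0$ independent of $t$, with $C$ depending only on $n,s,\kappa$ (and $c,T$ possibly depending also on the data), such that $$c\,\big|P_{x^{\lfloor\kappa\rfloor-1}\nabla^s u_1}\big|\leq\|u(t,\cdot)\|_{L^2}\leq C\big(\|u_0\|_{L^2}+\|\nabla^s u_1\|_{L^2\cap L^{1,\kappa}}\big)\qquad\text{for all } t\geq T.$$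
   Context: All function spaces are over $\mathbb{R}^n$; $\hat f$ is the Fourier transform. $L^{1,\kappa}:=\{f\in L^1:\|f\|_{L^{1,\kappa}}:=\|(1+|x|)^\kappa f\|_{L^1}<\infty\}$; $\|f\|_{X\cap Y}=\|f\|_X+\|f\|_Y$; $\lfloor\cdot\rfloor$ is the floor function. For real $s\geq0$, $\nabla^s$ is the Fourier multiplier with symbol $|\xi|^s$: "$\nabla^s u_1\in X$" means that $\hat u_1$ is a measurable function such that $|\xi|^s\hat u_1(\xi)$ is the Fourier transform of a function in $X$, denoted $\nabla^s u_1$. For an integer $k\geq0$, $P_{x^kf}$ denotes the vector of $k$-th order moments $\big(\int_{\mathbb{R}^n}x^\alpha f(x)\,dx\big)_{|\alpha|=k}$ and $|\cdot|$ its Euclidean norm. The solution is understood through its Fourier representation $\hat u(t,\xi)=\cos(|\xi|t)\,\hat u_0(\xi)+\frac{\sin(|\xi|t)}{|\xi|}\hat u_1(\xi)$, and $\|u(t,\cdot)\|_{L^2}$ is computed from $\hat u(t,\cdot)$ by Plancherel. *)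

theory Defs
  imports "HOL-Analysis.Analysis"
begin

text \<open>Elements of \<open>L\<^sup>p\<close> are represented by Borel measurable functions; identities between them
  are required almost everywhere only.\<close>

definition in_L2 :: "(real ^ 'n \<Rightarrow> complex) \<Rightarrow> bool" where
  "in_L2 f \<longleftrightarrow> f \<in> borel_measurable lborel \<and> integrable lborel (\<lambda>x. (norm (f x))\<^sup>2)"

definition L2_norm :: "(real ^ 'n \<Rightarrow> complex) \<Rightarrow> real" where
  "L2_norm f = sqrt (LINT x|lborel. (norm (f x))\<^sup>2)"

definition in_L1w :: "real \<Rightarrow> (real ^ 'n \<Rightarrow> complex) \<Rightarrow> bool" where
  "in_L1w \<kappa> f \<longleftrightarrow> integrable lborel f \<and>
     integrable lborel (\<lambda>x. (1 + norm x) powr \<kappa> * norm (f x))"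

definition L1w_norm :: "real \<Rightarrow> (real ^ 'n \<Rightarrow> complex) \<Rightarrow> real" where
  "L1w_norm \<kappa> f = (LINT x|lborel. (1 + norm x) powr \<kappa> * norm (f x))"

definition mi_order :: "('n::finite \<Rightarrow> nat) \<Rightarrow> nat" where
  "mi_order \<alpha> = (\<Sum>i\<in>UNIV. \<alpha> i)"

definition mi_power :: "real ^ 'n \<Rightarrow> ('n \<Rightarrow> nat) \<Rightarrow> real" where
  "mi_power x \<alpha> = (\<Prod>i\<in>UNIV. (x $ i) ^ \<alpha> i)"

definition moment :: "('n \<Rightarrow> nat) \<Rightarrow> (real ^ 'n \<Rightarrow> complex) \<Rightarrow> complex" where
  "moment \<alpha> f = (LINT x|lborel. mi_power x \<alpha> *\<^sub>R f x)"

text \<open>The Euclidean norm of the vector of all moments of order \<open>k\<close>.\<close>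

definition moments_norm :: "nat \<Rightarrow> (real ^ 'n \<Rightarrow> complex) \<Rightarrow> real" where
  "moments_norm k f = sqrt (\<Sum>\<alpha> | mi_order \<alpha> = k. (norm (moment \<alpha> f))\<^sup>2)"

text \<open>The unitary normalisation is used, so that Plancherel's identity reads
  \<open>L2_norm u = L2_norm u_hat\<close> without a constant.\<close>

definition fourier :: "(real ^ 'n \<Rightarrow> complex) \<Rightarrow> real ^ 'n \<Rightarrow> complex" where
  "fourier f \<xi> = (2 * pi) powr (- (real CARD('n) / 2)) *\<^sub>R
     (LINT x|lborel. cis (- (x \<bullet> \<xi>)) * f x)"

text \<open>\<open>g\<close> represents the Fourier--Plancherel transform of the square integrable function \<open>f\<close>:
  it is the \<open>L\<^sup>2\<close> limit of the Fourier integrals over balls. The convergence is expressed by the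
  nonnegative integral, since the Bochner integral of a non-integrable function is \<open>0\<close>.\<close>

definition fourier_L2 :: "(real ^ 'n \<Rightarrow> complex) \<Rightarrow> (real ^ 'n \<Rightarrow> complex) \<Rightarrow> bool" where
  "fourier_L2 f g \<longleftrightarrow> in_L2 g \<and>
     ((\<lambda>R::real. \<integral>\<^sup>+ \<xi>. ennreal ((norm
          (fourier (\<lambda>x. indicator (cball 0 R) x *\<^sub>R f x) \<xi> - g \<xi>))\<^sup>2) \<partial>lborel)
       \<longlongrightarrow> 0) at_top"

fun partials :: "'n list \<Rightarrow> (real ^ 'n \<Rightarrow> complex) \<Rightarrow> real ^ 'n \<Rightarrow> complex" where
  "partials [] \<phi> = \<phi>"
| "partials (i # is) \<phi> = (\<lambda>x. frechet_derivative (partials is \<phi>) (at x) (axis i 1))"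

definition schwartz :: "(real ^ 'n \<Rightarrow> complex) \<Rightarrow> bool" where
  "schwartz \<phi> \<longleftrightarrow> (\<forall>is. (\<forall>x. partials is \<phi> differentiable (at x)) \<and>
     (\<forall>m::nat. bounded (range (\<lambda>x. (1 + norm x) ^ m *\<^sub>R partials is \<phi> x))))"

text \<open>Tempered distributions are functionals on all functions of which only the values on
  Schwartz functions matter. Continuity is boundedness with respect to one of the seminorms
  \<open>sup {(1 + |x|)^N |\<partial>^\<beta> \<phi> x| : x, |\<beta>| \<le> N}\<close>, expressed through the upper bounds \<open>B\<close> of this set.\<close>

definition tempered_distribution :: "((real ^ 'n \<Rightarrow> complex) \<Rightarrow> complex) \<Rightarrow> bool" where
  "tempered_distribution u \<longleftrightarrow>
     (\<forall>\<phi> \<psi>. schwartz \<phi> \<longrightarrow> schwartz \<psi> \<longrightarrow> u (\<lambda>x. \<phi> x + \<psi> x) = u \<phi> + u \<psi>) \<and>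
     (\<forall>a \<phi>. schwartz \<phi> \<longrightarrow> u (\<lambda>x. a * \<phi> x) = a * u \<phi>) \<and>
     (\<exists>N::nat. \<exists>K::real. \<forall>\<phi> B. schwartz \<phi> \<longrightarrow>
        (\<forall>is x. length is \<le> N \<longrightarrow> (1 + norm x) ^ N * norm (partials is \<phi> x) \<le> B) \<longrightarrow>
        norm (u \<phi>) \<le> K * B)"

text \<open>The Fourier transform of the tempered distribution \<open>u\<close>, i.e. \<open>\<phi> \<mapsto> u (fourier \<phi>)\<close>, is
  the measurable function \<open>v\<close>.\<close>

definition fourier_distribution ::
  "((real ^ 'n \<Rightarrow> complex) \<Rightarrow> complex) \<Rightarrow> (real ^ 'n \<Rightarrow> complex) \<Rightarrow> bool" where
  "fourier_distribution u v \<longleftrightarrow> v \<in> borel_measurable lborel \<and>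
     (\<forall>\<phi>. schwartz \<phi> \<longrightarrow> integrable lborel (\<lambda>\<xi>. v \<xi> * \<phi> \<xi>) \<and>
        u (fourier \<phi>) = (LINT \<xi>|lborel. v \<xi> * \<phi> \<xi>))"

text \<open>\<open>f\<close> is \<open>\<nabla>^s u\<close>, for a distribution \<open>u\<close> with Fourier transform \<open>v\<close> and integrable \<open>f\<close>.
  For \<open>s = 0\<close>, \<open>0 powr 0 = 0\<close> matters only on the null set \<open>{0}\<close>.\<close>

definition is_nabla :: "real \<Rightarrow> (real ^ 'n \<Rightarrow> complex) \<Rightarrow> (real ^ 'n \<Rightarrow> complex) \<Rightarrow> bool" where
  "is_nabla s v f \<longleftrightarrow> (AE \<xi> in lborel. norm \<xi> powr s *\<^sub>R v \<xi> = fourier f \<xi>)"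

text \<open>The Fourier transform of the solution at time \<open>t\<close>; the value at \<open>\<xi> = 0\<close> is irrelevant.\<close>

definition wave_hat ::
  "(real ^ 'n \<Rightarrow> complex) \<Rightarrow> (real ^ 'n \<Rightarrow> complex) \<Rightarrow> real \<Rightarrow> real ^ 'n \<Rightarrow> complex" where
  "wave_hat u0_hat u1_hat t \<xi> =
     cos (norm \<xi> * t) *\<^sub>R u0_hat \<xi> + (sin (norm \<xi> * t) / norm \<xi>) *\<^sub>R u1_hat \<xi>"

end

theory Submission
  imports Defs "HOL-Probability.Probability"
begin

text \<open>
  With \<open>a\<close> the transform of \<open>u\<^sub>0\<close> and \<open>b = \<xi> \<mapsto> u\<^sub>1_hat \<xi> / |\<xi>|\<close>, the solution is
  \<open>cos (|\<xi>| t) a + sin (|\<xi>| t) b\<close>. Put \<open>f = \<nabla>^s u\<^sub>1\<close> and \<open>k = floor \<kappa> - 1\<close>. The moments of order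
  below \<open>k\<close> vanish, so Taylor expansion of the exponential gives \<open>|f_hat \<xi>| \<le> |\<xi>|^k \<integral> |x|^k |f|\<close>,
  and \<open>|b| = |\<xi>|^(-1-s) |f_hat|\<close> is square integrable near \<open>0\<close> because \<open>2 (k - 1 - s) > - n\<close>; away
  from \<open>0\<close> it is at most \<open>|f_hat|\<close>. This proves the upper bound. Expanding the square,
  \<open>|cos (|\<xi>| t) a + sin (|\<xi>| t) b|^2\<close> is \<open>(|a|^2 + |b|^2) / 2\<close> plus terms oscillating with phase
  \<open>2 |\<xi>| t\<close>, whose integrals tend to \<open>0\<close> by the Riemann--Lebesgue lemma. The squared norm of the
  solution thus tends to \<open>(\<parallel>a\<parallel>^2 + \<parallel>b\<parallel>^2) / 2\<close>, which is positive since a nonzero moment of order \<open>k\<close>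
  prevents \<open>f_hat\<close> from vanishing.
\<close>

section \<open>The Fourier transform on square integrable functions\<close>

lemma borel_measurable_cis [measurable (raw)]:
  "f \<in> borel_measurable M \<Longrightarrow> (\<lambda>x. cis (f x)) \<in> borel_measurable M"
  by (rule borel_measurable_continuous_on[OF continuous_on_cis[OF continuous_on_id]])

text \<open>The characteristic function of the standard normal distribution, after the substitution
  x -> \<open>sqrt a\<close> * x.\<close>

lemma gaussian_char_real:
  fixes a z :: real
  assumes "a > 0"
  shows "integrable lborel (\<lambda>x. complex_of_real (exp (- a * x\<^sup>2 / 2)) * cis (- (z * x)))"
    and "(LINT x|lborel. complex_of_real (exp (- a * x\<^sup>2 / 2)) * cis (- (z * x)))
          = complex_of_real (sqrt (2 * pi / a) * exp (- z\<^sup>2 / (2 * a)))"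
proof -
  define c where "c = sqrt a"
  have c: "c > 0" "c * c = a"
    using assms by (auto simp: c_def)
  have I: "integrable lborel (\<lambda>x. std_normal_density x *\<^sub>R cis (t * x))" for t
    by (rule Bochner_Integration.integrable_bound[OF integrable_std_normal_moment[of 0]])
       (auto intro!: AE_I2)
  have E: "(LINT x|lborel. std_normal_density x *\<^sub>R cis (t * x)) = complex_of_real (exp (- (t\<^sup>2) / 2))" for t
    using char_std_normal_distribution
    by (simp add: char_def fun_eq_iff integral_density cis_conv_exp)
  \<comment> \<open>The summand \<open>0\<close> gives the integrand the shape
    \<open>t + c * x\<close> that the affine substitution rules produce.\<close>
  have eq: "sqrt (2 * pi) *\<^sub>R (std_normal_density (0 + c * x) *\<^sub>R cis (- (z / c) * (0 + c * x)))
     = complex_of_real (exp (- a * x\<^sup>2 / 2)) * cis (- (z * x))" for x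
    using c by (auto simp: std_normal_density_def scaleR_conv_of_real power_mult_distrib power2_eq_square mult_ac)
  have "integrable lborel (\<lambda>x. std_normal_density (0 + c * x) *\<^sub>R cis (- (z / c) * (0 + c * x)))"
    using c lborel_integrable_real_affine[OF I[of "- (z / c)"], of c 0] by simp
  then have "integrable lborel (\<lambda>x. sqrt (2 * pi) *\<^sub>R (std_normal_density (0 + c * x) *\<^sub>R cis (- (z / c) * (0 + c * x))))"
    by (rule integrable_scaleR_right)
  then show "integrable lborel (\<lambda>x. complex_of_real (exp (- a * x\<^sup>2 / 2)) * cis (- (z * x)))"
    unfolding eq .
  have "(LINT x|lborel. complex_of_real (exp (- a * x\<^sup>2 / 2)) * cis (- (z * x)))
     = sqrt (2 * pi) *\<^sub>R (LINT x|lborel. std_normal_density (0 + c * x) *\<^sub>R cis (- (z / c) * (0 + c * x)))"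
    by (subst integral_scaleR_right[symmetric]) (simp only: eq)
  also have "(LINT x|lborel. std_normal_density (0 + c * x) *\<^sub>R cis (- (z / c) * (0 + c * x)))
     = inverse c *\<^sub>R complex_of_real (exp (- ((- (z / c))\<^sup>2) / 2))"
    using c lborel_integral_real_affine[of c "\<lambda>x. std_normal_density x *\<^sub>R cis (- (z / c) * x)" 0]
    by (simp only: E) simp
  also have "sqrt (2 * pi) *\<^sub>R (inverse c *\<^sub>R complex_of_real (exp (- ((- (z / c))\<^sup>2) / 2)))
     = complex_of_real (sqrt (2 * pi / a) * exp (- z\<^sup>2 / (2 * a)))"
    using c assms by (simp add: scaleR_conv_of_real power_divide real_sqrt_divide c_def divide_simps)
  finally show "(LINT x|lborel. complex_of_real (exp (- a * x\<^sup>2 / 2)) * cis (- (z * x)))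
          = complex_of_real (sqrt (2 * pi / a) * exp (- z\<^sup>2 / (2 * a)))" .
qed

text \<open>Lebesgue measure is the image of a product of one-dimensional Lebesgue measures under
  the coordinate map (\<open>lborel_eq\<close>), so integrals of products of functions of separate
  coordinates factor.\<close>

lemma lborel_integral_prod_Basis:
  fixes f :: "'a::euclidean_space \<Rightarrow> real \<Rightarrow> complex"
  assumes "\<And>b. b \<in> Basis \<Longrightarrow> integrable lborel (f b)"
  shows "integrable lborel (\<lambda>x::'a. \<Prod>b\<in>Basis. f b (x \<bullet> b))"
    and "(LINT x::'a|lborel. (\<Prod>b\<in>Basis. f b (x \<bullet> b))) = (\<Prod>b\<in>Basis. LINT t|lborel. f b t)"
proof -
  interpret product_sigma_finite "\<lambda>_::'a. lborel :: real measure" ..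
  have [measurable]: "\<And>b. b \<in> Basis \<Longrightarrow> f b \<in> borel_measurable borel"
    using assms[THEN borel_measurable_integrable] by simp
  have m: "(\<lambda>x::'a. \<Prod>b\<in>Basis. f b (x \<bullet> b)) \<in> borel_measurable borel"
    by measurable
  have s: "(\<lambda>g. \<Sum>b\<in>Basis. g b *\<^sub>R b) \<in> (\<Pi>\<^sub>M b\<in>(Basis::'a set). lborel) \<rightarrow>\<^sub>M borel"
    by measurable
  show "integrable lborel (\<lambda>x::'a. \<Prod>b\<in>Basis. f b (x \<bullet> b))"
    apply (subst lborel_eq)
    apply (subst integrable_distr_eq[OF s m])
    using product_integrable_prod[OF finite_Basis assms]
    by (simp add: inner_sum_left inner_Basis if_distrib cong: if_cong)
  show "(LINT x::'a|lborel. (\<Prod>b\<in>Basis. f b (x \<bullet> b))) = (\<Prod>b\<in>Basis. LINT t|lborel. f b t)"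
    apply (subst lborel_eq)
    apply (subst integral_distr[OF s m])
    using product_integral_prod[OF finite_Basis assms]
    by (simp add: inner_sum_left inner_Basis if_distrib cong: if_cong)
qed

text \<open>Both the Gaussian and the character factor over the coordinates, which reduces the claim
  to \<open>gaussian_char_real\<close> in each of them.\<close>

lemma gaussian_char:
  fixes z :: "'a::euclidean_space"
  assumes a: "a > 0"
  shows "integrable lborel (\<lambda>x::'a. complex_of_real (exp (- a * (norm x)\<^sup>2 / 2)) * cis (- (z \<bullet> x)))"
    and "(LINT x::'a|lborel. complex_of_real (exp (- a * (norm x)\<^sup>2 / 2)) * cis (- (z \<bullet> x)))
          = complex_of_real (sqrt (2 * pi / a) ^ DIM('a) * exp (- (norm z)\<^sup>2 / (2 * a)))"
proof -
  define f where "f b x = complex_of_real (exp (- a * x\<^sup>2 / 2)) * cis (- ((z \<bullet> b) * x))" for b x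
  have cis_sum: "(\<Prod>b\<in>A. cis (g b)) = cis (sum g A)" if "finite A" for g :: "'a \<Rightarrow> real" and A
    using that by (induction rule: finite_induct) (auto simp: cis_mult)
  have norm_sum: "(norm x)\<^sup>2 = (\<Sum>b\<in>Basis. (x \<bullet> b)\<^sup>2)" for x :: 'a
    by (subst power2_norm_eq_inner, subst euclidean_inner) (simp add: power2_eq_square)
  have eq: "(\<Prod>b\<in>Basis. f b (x \<bullet> b)) = complex_of_real (exp (- a * (norm x)\<^sup>2 / 2)) * cis (- (z \<bullet> x))" for x
  proof -
    have "(\<Sum>b\<in>Basis. - a * (x \<bullet> b)\<^sup>2 / 2) = - a * (norm x)\<^sup>2 / 2"
      by (simp add: norm_sum sum_negf sum_distrib_left sum_divide_distrib)
    moreover have "(\<Sum>b\<in>Basis. - ((z \<bullet> b) * (x \<bullet> b))) = - (z \<bullet> x)"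
      by (simp add: sum_negf euclidean_inner[of z x])
    ultimately show ?thesis
      unfolding f_def prod.distrib of_real_prod[symmetric] exp_sum[OF finite_Basis, symmetric]
        cis_sum[OF finite_Basis] by simp
  qed
  have i: "integrable lborel (f b)" if "b \<in> Basis" for b
    unfolding f_def by (rule gaussian_char_real[OF a])
  show "integrable lborel (\<lambda>x::'a. complex_of_real (exp (- a * (norm x)\<^sup>2 / 2)) * cis (- (z \<bullet> x)))"
    using lborel_integral_prod_Basis(1)[of f, OF i] unfolding eq .
  have "(LINT x::'a|lborel. complex_of_real (exp (- a * (norm x)\<^sup>2 / 2)) * cis (- (z \<bullet> x)))
      = (\<Prod>b\<in>Basis. LINT t|lborel. f b t)"
    using lborel_integral_prod_Basis(2)[of f, OF i] unfolding eq .
  also have "\<dots> = (\<Prod>b\<in>(Basis::'a set). complex_of_real (sqrt (2 * pi / a) * exp (- (z \<bullet> b)\<^sup>2 / (2 * a))))"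
    unfolding f_def gaussian_char_real(2)[OF a] ..
  also have "\<dots> = complex_of_real (sqrt (2 * pi / a) ^ DIM('a) * exp (- (norm z)\<^sup>2 / (2 * a)))"
  proof -
    have "(\<Sum>b\<in>Basis. - (z \<bullet> b)\<^sup>2 / (2 * a)) = - (norm z)\<^sup>2 / (2 * a)"
      by (simp add: norm_sum sum_negf sum_divide_distrib)
    then show ?thesis
      unfolding of_real_prod[symmetric] prod.distrib exp_sum[OF finite_Basis, symmetric] by simp
  qed
  finally show "(LINT x::'a|lborel. complex_of_real (exp (- a * (norm x)\<^sup>2 / 2)) * cis (- (z \<bullet> x)))
          = complex_of_real (sqrt (2 * pi / a) ^ DIM('a) * exp (- (norm z)\<^sup>2 / (2 * a)))" .
qed

lemma gaussian_integral:
  assumes a: "a > 0"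
  shows "integrable lborel (\<lambda>x::'a::euclidean_space. exp (- a * (norm x)\<^sup>2 / 2))"
    and "(LINT x::'a|lborel. exp (- a * (norm x)\<^sup>2 / 2)) = sqrt (2 * pi / a) ^ DIM('a)"
proof -
  have *: "integrable lborel (\<lambda>x::'a. complex_of_real (exp (- a * (norm x)\<^sup>2 / 2)))"
    using gaussian_char(1)[OF a, of 0] by simp
  then show "integrable lborel (\<lambda>x::'a. exp (- a * (norm x)\<^sup>2 / 2))"
    by (simp only: complex_of_real_integrable_eq)
  have "complex_of_real (LINT x::'a|lborel. exp (- a * (norm x)\<^sup>2 / 2))
     = complex_of_real (sqrt (2 * pi / a) ^ DIM('a))"
    using gaussian_char(2)[OF a, of 0] by simp
  then show "(LINT x::'a|lborel. exp (- a * (norm x)\<^sup>2 / 2)) = sqrt (2 * pi / a) ^ DIM('a)"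
    by (simp only: of_real_eq_iff)
qed

section \<open>Fubini on product spaces and the Plancherel inequality\<close>

lemma integrable_lborel_tensor:
  fixes f :: "'a::euclidean_space \<Rightarrow> 'c::{real_normed_field, banach, second_countable_topology}"
    and g :: "'b::euclidean_space \<Rightarrow> 'c"
  assumes f: "integrable lborel f" and g: "integrable lborel g"
  shows "integrable (lborel \<Otimes>\<^sub>M lborel) (\<lambda>(x, y). f x * g y)"
    and "(LINT (x, y)|(lborel \<Otimes>\<^sub>M lborel). f x * g y) = (LINT x|lborel. f x) * (LINT y|lborel. g y)"
proof -
  have [measurable]: "f \<in> borel_measurable lborel" "g \<in> borel_measurable lborel"
    using f g by auto
  show i: "integrable (lborel \<Otimes>\<^sub>M lborel) (\<lambda>(x, y). f x * g y)"
    by (rule lborel_pair.Fubini_integrable) (use f g in \<open>auto simp: norm_mult\<close>)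
  show "(LINT (x, y)|(lborel \<Otimes>\<^sub>M lborel). f x * g y) = (LINT x|lborel. f x) * (LINT y|lborel. g y)"
    using lborel_pair.integral_fst[OF i] by simp
qed

lemma nn_integral_lborel_translate:
  fixes g :: "'a::euclidean_space \<Rightarrow> ennreal"
  assumes [measurable]: "g \<in> borel_measurable borel"
  shows "(\<integral>\<^sup>+y. g (c + y) \<partial>lborel) = (\<integral>\<^sup>+y. g y \<partial>lborel)"
  by (subst (2) lborel_distr_plus[of c, symmetric], subst nn_integral_distr) auto

text \<open>As |z|^2 = z * \<open>cnj z\<close>, the square is a double integral. The variable
  \<open>\<xi>\<close> then occurs only in a character at x - y, so an integration over
  \<open>\<xi>\<close> can be carried out first.\<close>

lemma cmod_power2_fourier_integral:
  fixes f :: "'a::euclidean_space \<Rightarrow> complex"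
  assumes f: "integrable lborel f"
  shows "complex_of_real ((norm (LINT x|lborel. cis (- (x \<bullet> \<xi>)) * f x))\<^sup>2)
    = (LINT p|lborel. cis (- ((fst p - snd p) \<bullet> \<xi>)) * (f (fst p) * cnj (f (snd p))))"
proof -
  define h where "h = (\<lambda>x. cis (- (x \<bullet> \<xi>)) * f x)"
  have [measurable]: "f \<in> borel_measurable lborel" using f by auto
  have h: "integrable lborel h"
    unfolding h_def by (rule Bochner_Integration.integrable_bound[OF f]) (auto simp: norm_mult)
  have cis_split: "cis (- ((x - y) \<bullet> \<xi>)) = cis (- (x \<bullet> \<xi>)) * cis (y \<bullet> \<xi>)" for x y
    by (simp add: cis_mult inner_diff_left)
  have "complex_of_real ((norm (integral\<^sup>L lborel h))\<^sup>2) = integral\<^sup>L lborel h * cnj (integral\<^sup>L lborel h)"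
    by (rule complex_norm_square)
  also have "cnj (integral\<^sup>L lborel h) = (LINT y|lborel. cnj (h y))"
    by (simp add: Bochner_Integration.integral_cnj)
  also have "integral\<^sup>L lborel h * (LINT y|lborel. cnj (h y)) = (LINT (x, y)|(lborel \<Otimes>\<^sub>M lborel). h x * cnj (h y))"
    using h by (subst integrable_lborel_tensor(2)) auto
  also have "\<dots> = (LINT p|lborel. cis (- ((fst p - snd p) \<bullet> \<xi>)) * (f (fst p) * cnj (f (snd p))))"
    unfolding lborel_prod
    by (rule Bochner_Integration.integral_cong)
       (auto simp: h_def cis_cnj cis_split)
  finally show ?thesis unfolding h_def .
qed

lemma integrable_lborel_tensor_fst_snd:
  fixes f :: "'a::euclidean_space \<Rightarrow> 'c::{real_normed_field, banach, second_countable_topology}"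
    and g :: "'b::euclidean_space \<Rightarrow> 'c"
  assumes "integrable lborel f" and "integrable lborel g"
  shows "integrable lborel (\<lambda>p. f (fst p) * g (snd p))"
  using integrable_lborel_tensor(1)[OF assms] by (simp add: lborel_prod case_prod_beta')

text \<open>The Gaussian weight makes Fubini applicable: integrating over \<open>\<xi>\<close> first turns it into the kernel
  \<open>S (x - y)\<close> of total mass \<open>(2 \<pi>)^n\<close>, and \<open>|f x| |f y| \<le> (|f x|^2 + |f y|^2) / 2\<close> finishes.\<close>

lemma nn_integral_fourier_gaussian_le:
  fixes f :: "'a::euclidean_space \<Rightarrow> complex"
  assumes f: "integrable lborel f" and f2: "integrable lborel (\<lambda>x. (norm (f x))\<^sup>2)" and e: "e > 0"
  shows "(\<integral>\<^sup>+\<xi>. ennreal (exp (- e * (norm \<xi>)\<^sup>2 / 2) * (norm (LINT x|lborel. cis (- (x \<bullet> \<xi>)) * f x))\<^sup>2) \<partial>lborel)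
    \<le> ennreal ((2 * pi) ^ DIM('a) * (LINT x|lborel. (norm (f x))\<^sup>2))"
proof -
  let ?G = "\<lambda>\<xi>::'a. exp (- e * (norm \<xi>)\<^sup>2 / 2)"
  let ?F = "\<lambda>\<xi>. LINT x|lborel. cis (- (x \<bullet> \<xi>)) * f x"
  define c where "c = sqrt (2 * pi / e) ^ DIM('a)"
  define S where "S = (\<lambda>z::'a. c * exp (- (norm z)\<^sup>2 / (2 * e)))"
  define K where "K = (\<lambda>p::'a \<times> 'a. f (fst p) * cnj (f (snd p)))"
  define H where "H = (\<lambda>\<xi> p. complex_of_real (?G \<xi>) * (cis (- ((fst p - snd p) \<bullet> \<xi>)) * K p))"
  have c: "c > 0" using e by (simp add: c_def)
  have [measurable]: "f \<in> borel_measurable borel" using f by auto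
  have Fm [measurable]: "?F \<in> borel_measurable borel"
    by measurable
  have K: "integrable lborel K"
    unfolding K_def using f by (intro integrable_lborel_tensor_fst_snd) auto
  then have [measurable]: "K \<in> borel_measurable borel" by auto
  have [measurable]: "fst \<in> borel_measurable (borel :: ('a \<times> 'a) measure)"
    "snd \<in> borel_measurable (borel :: ('a \<times> 'a) measure)"
    by (intro borel_measurable_continuous_onI continuous_intros)+
  have Hm: "case_prod H \<in> borel_measurable (lborel \<Otimes>\<^sub>M lborel)"
    unfolding H_def by measurable
  \<comment> \<open>The character has modulus 1 and leaves no decay in \<open>\<xi>\<close>; the
    Gaussian weight supplies the integrable majorant on the product space.\<close>
  have "integrable (lborel \<Otimes>\<^sub>M lborel) (\<lambda>(\<xi>, p). complex_of_real (?G \<xi>) * K p)"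
    using gaussian_integral(1)[OF e] K by (intro integrable_lborel_tensor) auto
  then have H: "integrable (lborel \<Otimes>\<^sub>M lborel) (case_prod H)"
    by (rule Bochner_Integration.integrable_bound[OF _ Hm]) (auto simp: H_def norm_mult)
  have F: "complex_of_real (?G \<xi> * (norm (?F \<xi>))\<^sup>2) = (LINT p|lborel. H \<xi> p)" for \<xi>
    unfolding of_real_mult cmod_power2_fourier_integral[OF f] H_def K_def by simp
  have "integrable lborel (\<lambda>\<xi>. complex_of_real (?G \<xi> * (norm (?F \<xi>))\<^sup>2))"
    unfolding F by (rule lborel_pair.integrable_fst[OF H])
  then have Fi: "integrable lborel (\<lambda>\<xi>. ?G \<xi> * (norm (?F \<xi>))\<^sup>2)"
    by (simp only: complex_of_real_integrable_eq)
  have SH: "(LINT \<xi>|lborel. H \<xi> p) = complex_of_real (S (fst p - snd p)) * K p" for p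
  proof -
    have "(LINT \<xi>|lborel. H \<xi> p) = (LINT \<xi>|lborel. (complex_of_real (?G \<xi>) * cis (- ((fst p - snd p) \<bullet> \<xi>))) * K p)"
      unfolding H_def by (simp only: mult.assoc)
    also have "\<dots> = (LINT \<xi>|lborel. complex_of_real (?G \<xi>) * cis (- ((fst p - snd p) \<bullet> \<xi>))) * K p"
      by (rule Bochner_Integration.integral_mult_left_zero)
    finally show ?thesis
      unfolding gaussian_char(2)[OF e] S_def c_def .
  qed
  have *: "complex_of_real (LINT \<xi>|lborel. ?G \<xi> * (norm (?F \<xi>))\<^sup>2) = (LINT p|lborel. complex_of_real (S (fst p - snd p)) * K p)"
    unfolding integral_complex_of_real[symmetric] F SH[symmetric]
    by (rule lborel_pair.Fubini_integral[OF H, symmetric])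
  have "0 \<le> (LINT \<xi>|lborel. ?G \<xi> * (norm (?F \<xi>))\<^sup>2)"
    by (intro Bochner_Integration.integral_nonneg) auto
  then have "ennreal (LINT \<xi>|lborel. ?G \<xi> * (norm (?F \<xi>))\<^sup>2) = ennreal (norm (LINT p|lborel. complex_of_real (S (fst p - snd p)) * K p))"
    unfolding *[symmetric] by (simp only: norm_of_real abs_of_nonneg)
  also have "\<dots> \<le> (\<integral>\<^sup>+p. norm (complex_of_real (S (fst p - snd p)) * K p) \<partial>lborel)"
    by (rule integral_norm_bound_ennreal) (use lborel_pair.integrable_snd[OF H] in \<open>simp add: SH\<close>)
  \<comment> \<open>Each summand contains \<open>f\<close> at one variable only, and
    \<open>S\<close>, being even, is written with that variable first. Both summands can therefore
    be integrated over the other variable by the same computation.\<close>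
  also have "\<dots> \<le> (\<integral>\<^sup>+p. ennreal ((norm (f (fst p)))\<^sup>2 / 2) * ennreal (S (fst p - snd p))
       + ennreal ((norm (f (snd p)))\<^sup>2 / 2) * ennreal (S (snd p - fst p)) \<partial>lborel)"
  proof (rule nn_integral_mono)
    fix p :: "'a \<times> 'a"
    have S: "S (snd p - fst p) = S (fst p - snd p)" "0 \<le> S (fst p - snd p)"
      using c by (auto simp: S_def norm_minus_commute)
    have "norm (K p) \<le> (norm (f (fst p)))\<^sup>2 / 2 + (norm (f (snd p)))\<^sup>2 / 2"
      using sum_squares_bound[of "norm (f (fst p))" "norm (f (snd p))"]
      by (simp add: K_def norm_mult)
    then have "norm (complex_of_real (S (fst p - snd p)) * K p)
       \<le> S (fst p - snd p) * ((norm (f (fst p)))\<^sup>2 / 2 + (norm (f (snd p)))\<^sup>2 / 2)"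
      using S by (auto simp: norm_mult intro!: mult_left_mono)
    then show "ennreal (norm (complex_of_real (S (fst p - snd p)) * K p)) \<le> ennreal ((norm (f (fst p)))\<^sup>2 / 2) * ennreal (S (fst p - snd p))
       + ennreal ((norm (f (snd p)))\<^sup>2 / 2) * ennreal (S (snd p - fst p))"
      using S by (simp add: ennreal_mult[symmetric] ennreal_plus[symmetric] algebra_simps del: ennreal_plus)
  qed
  also have "\<dots> = (\<integral>\<^sup>+p. ennreal ((norm (f (fst p)))\<^sup>2 / 2) * ennreal (S (fst p - snd p)) \<partial>lborel)
       + (\<integral>\<^sup>+p. ennreal ((norm (f (snd p)))\<^sup>2 / 2) * ennreal (S (snd p - fst p)) \<partial>lborel)"
    by (rule nn_integral_add) (auto simp: S_def)
  also have "\<dots> = (\<integral>\<^sup>+x. \<integral>\<^sup>+y. ennreal ((norm (f x))\<^sup>2 / 2) * ennreal (S (x - y)) \<partial>lborel \<partial>lborel)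
     + (\<integral>\<^sup>+y. \<integral>\<^sup>+x. ennreal ((norm (f y))\<^sup>2 / 2) * ennreal (S (y - x)) \<partial>lborel \<partial>lborel)"
    unfolding lborel_prod[symmetric]
  proof (rule arg_cong2[where f = "(+)"])
    show "(\<integral>\<^sup>+p. ennreal ((norm (f (fst p)))\<^sup>2 / 2) * ennreal (S (fst p - snd p)) \<partial>(lborel \<Otimes>\<^sub>M lborel))
      = (\<integral>\<^sup>+x. \<integral>\<^sup>+y. ennreal ((norm (f x))\<^sup>2 / 2) * ennreal (S (x - y)) \<partial>lborel \<partial>lborel)"
      by (subst lborel.nn_integral_fst[symmetric]) (simp_all add: S_def)
    show "(\<integral>\<^sup>+p. ennreal ((norm (f (snd p)))\<^sup>2 / 2) * ennreal (S (snd p - fst p)) \<partial>(lborel \<Otimes>\<^sub>M lborel))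
      = (\<integral>\<^sup>+y. \<integral>\<^sup>+x. ennreal ((norm (f y))\<^sup>2 / 2) * ennreal (S (y - x)) \<partial>lborel \<partial>lborel)"
      by (subst lborel_pair.nn_integral_snd[symmetric]) (simp_all add: S_def)
  qed
  also have "\<dots> = (\<integral>\<^sup>+x. ennreal ((norm (f x))\<^sup>2) * ennreal ((2 * pi) ^ DIM('a)) \<partial>lborel)"
  proof -
    have S: "(\<integral>\<^sup>+y. ennreal (S (x - y)) \<partial>lborel) = ennreal ((2 * pi) ^ DIM('a))" for x
    proof -
      have "(\<integral>\<^sup>+y. ennreal (S (x - y)) \<partial>lborel) = (\<integral>\<^sup>+y. ennreal (S (- x + y)) \<partial>lborel)"
        by (simp add: S_def norm_minus_commute)
      also have "\<dots> = (\<integral>\<^sup>+y. ennreal (S y) \<partial>lborel)"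
        by (rule nn_integral_lborel_translate) (simp add: S_def)
      \<comment> \<open>\<open>S\<close> is a multiple of the Gaussian with parameter
        \<open>1 / e\<close>; the powers of \<open>e\<close> in \<open>c\<close> and in its integral
        cancel, so the bound is uniform in \<open>e\<close>.\<close>
      also have "\<dots> = ennreal (LINT y|lborel. S y)"
        using gaussian_integral(1)[of "1 / e", where 'a = 'a] c e
        by (intro nn_integral_eq_integral) (auto simp: S_def mult.commute[of e 2])
      also have "(LINT y|lborel. S y) = c * sqrt (2 * pi * e) ^ DIM('a)"
        using gaussian_integral(2)[of "1 / e", where 'a = 'a] e by (simp add: S_def mult.commute[of e 2])
      also have "\<dots> = (2 * pi) ^ DIM('a)"
      proof -
        have "2 * pi / e * (2 * pi * e) = (2 * pi)\<^sup>2"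
          using e by (simp add: power2_eq_square)
        then have "sqrt (2 * pi / e) * sqrt (2 * pi * e) = 2 * pi"
          unfolding real_sqrt_mult[symmetric] by (simp only: real_sqrt_abs) simp
        then show ?thesis
          unfolding c_def power_mult_distrib[symmetric] by simp
      qed
      finally show ?thesis .
    qed
    have "(\<integral>\<^sup>+y. ennreal ((norm (f x))\<^sup>2 / 2) * ennreal (S (x - y)) \<partial>lborel)
      = ennreal ((norm (f x))\<^sup>2 / 2) * ennreal ((2 * pi) ^ DIM('a))" for x
      by (subst nn_integral_cmult) (auto simp: S, simp add: S_def)
    then show ?thesis
      by (simp add: nn_integral_add[symmetric] ennreal_mult[symmetric] ennreal_plus[symmetric] mult_ac
          del: ennreal_plus)
  qed
  also have "\<dots> = ennreal ((2 * pi) ^ DIM('a) * (LINT x|lborel. (norm (f x))\<^sup>2))"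
    using f2 by (simp add: ennreal_mult[symmetric] nn_integral_eq_integral mult.commute)
  finally show ?thesis
    using Fi by (simp add: nn_integral_eq_integral)
qed

lemma borel_measurable_fourier [measurable]:
  assumes [measurable]: "f \<in> borel_measurable borel"
  shows "fourier f \<in> borel_measurable borel"
  unfolding fourier_def[abs_def] by measurable

text \<open>One half of Plancherel's identity. The weights with e = 1 / (k + 1) tend to 1 pointwise,
  and Fatou's lemma removes them from the uniform weighted bound. The unitary normalisation enters
  as \<open>c\<^sup>2 * (2 * pi) ^ ?N = 1\<close>.\<close>

lemma nn_integral_fourier_power2_le:
  fixes f :: "real ^ 'n \<Rightarrow> complex"
  assumes f: "integrable lborel f" and f2: "integrable lborel (\<lambda>x. (norm (f x))\<^sup>2)"
  shows "(\<integral>\<^sup>+\<xi>. ennreal ((norm (fourier f \<xi>))\<^sup>2) \<partial>lborel) \<le> ennreal (LINT x|lborel. (norm (f x))\<^sup>2)"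
proof -
  let ?N = "CARD('n)"
  let ?F = "\<lambda>\<xi>. LINT x|lborel. cis (- (x \<bullet> \<xi>)) * f x"
  define c where "c = (2 * pi) powr (- (real ?N / 2))"
  define h where "h k \<xi> = ennreal (exp (- (1 / real (Suc k)) * (norm \<xi>)\<^sup>2 / 2) * (norm (fourier f \<xi>))\<^sup>2)" for k \<xi>
  have [measurable]: "f \<in> borel_measurable borel" using f by auto
  have "c\<^sup>2 = (2 * pi) powr (- real ?N)"
    unfolding c_def power2_eq_square powr_add[symmetric] by simp
  then have c2: "c\<^sup>2 * (2 * pi) ^ ?N = 1"
    by (simp add: powr_minus powr_realpow field_simps)
  have F: "norm (fourier f \<xi>) = c * norm (?F \<xi>)" for \<xi>
    unfolding fourier_def c_def by simp
  have le: "(\<integral>\<^sup>+\<xi>. h k \<xi> \<partial>lborel) \<le> ennreal (LINT x|lborel. (norm (f x))\<^sup>2)" for k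
  proof -
    let ?e = "1 / real (Suc k)"
    have "(\<integral>\<^sup>+\<xi>. h k \<xi> \<partial>lborel) = (\<integral>\<^sup>+\<xi>. ennreal (c\<^sup>2) * ennreal (exp (- ?e * (norm \<xi>)\<^sup>2 / 2) * (norm (?F \<xi>))\<^sup>2) \<partial>lborel)"
      by (intro nn_integral_cong)
         (simp add: h_def F power_mult_distrib ennreal_mult[symmetric] algebra_simps)
    also have "\<dots> = ennreal (c\<^sup>2) * (\<integral>\<^sup>+\<xi>. ennreal (exp (- ?e * (norm \<xi>)\<^sup>2 / 2) * (norm (?F \<xi>))\<^sup>2) \<partial>lborel)"
      by (intro nn_integral_cmult) measurable
    also have "\<dots> \<le> ennreal (c\<^sup>2) * ennreal ((2 * pi) ^ DIM(real ^ 'n) * (LINT x|lborel. (norm (f x))\<^sup>2))"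
      by (intro mult_left_mono nn_integral_fourier_gaussian_le[OF f f2]) auto
    also have "\<dots> = ennreal (LINT x|lborel. (norm (f x))\<^sup>2)"
      using c2 by (simp add: ennreal_mult'[symmetric] mult.assoc[symmetric])
    finally show ?thesis .
  qed
  have lim: "(\<lambda>k. h k \<xi>) \<longlonglongrightarrow> ennreal ((norm (fourier f \<xi>))\<^sup>2)" for \<xi>
  proof -
    have "(\<lambda>k. exp (- (1 / real (Suc k)) * (norm \<xi>)\<^sup>2 / 2) * (norm (fourier f \<xi>))\<^sup>2)
       \<longlonglongrightarrow> exp (- 0 * (norm \<xi>)\<^sup>2 / 2) * (norm (fourier f \<xi>))\<^sup>2"
      by (intro tendsto_intros lim_1_over_n[THEN LIMSEQ_Suc]) auto
    then show ?thesis
      unfolding h_def by (intro tendsto_ennrealI) simp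
  qed
  have "(\<integral>\<^sup>+\<xi>. ennreal ((norm (fourier f \<xi>))\<^sup>2) \<partial>lborel) = (\<integral>\<^sup>+\<xi>. liminf (\<lambda>k. h k \<xi>) \<partial>lborel)"
    using lim_imp_Liminf[OF sequentially_bot lim] by simp
  also have "\<dots> \<le> liminf (\<lambda>k. \<integral>\<^sup>+\<xi>. h k \<xi> \<partial>lborel)"
    by (intro nn_integral_liminf) (auto simp: h_def)
  also have "\<dots> \<le> ennreal (LINT x|lborel. (norm (f x))\<^sup>2)"
    by (rule order_trans[OF Liminf_mono[OF always_eventually] eq_refl[OF Liminf_const]]) (auto intro: le)
  finally show ?thesis .
qed

lemma fourier_in_L2:
  fixes f :: "real ^ 'n \<Rightarrow> complex"
  assumes f: "integrable lborel f" and f2: "in_L2 f"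
  shows "in_L2 (fourier f)" and "L2_norm (fourier f) \<le> L2_norm f"
proof -
  have i: "integrable lborel (\<lambda>x. (norm (f x))\<^sup>2)" using f2 by (simp add: in_L2_def)
  have [measurable]: "f \<in> borel_measurable borel" using f by auto
  note le = nn_integral_fourier_power2_le[OF f i]
  have "integrable lborel (\<lambda>\<xi>. (norm (fourier f \<xi>))\<^sup>2)"
    by (rule integrableI_bounded) (use le in \<open>auto simp: le_less_trans\<close>)
  then show "in_L2 (fourier f)" by (simp add: in_L2_def)
  show "L2_norm (fourier f) \<le> L2_norm f"
    unfolding L2_norm_def
    using le \<open>integrable lborel (\<lambda>\<xi>. (norm (fourier f \<xi>))\<^sup>2)\<close> by (simp add: nn_integral_eq_integral)
qed

text \<open>The truncations of \<open>f\<close> to balls lie in both L^1 and L^2, so the preceding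
  inequality applies to them. The factor 2 comes from |g|^2 \<le> 2 |F|^2 + 2 |F - g|^2 with F the
  transform of a truncation; the last term disappears as R grows. A numerical factor suffices, as it
  only enters the final constant.\<close>

lemma fourier_L2_norm_le:
  fixes f g :: "real ^ 'n \<Rightarrow> complex"
  assumes f2: "in_L2 f" and g: "fourier_L2 f g"
  shows "(L2_norm g)\<^sup>2 \<le> 2 * (L2_norm f)\<^sup>2"
proof -
  have fi: "integrable lborel (\<lambda>x. (norm (f x))\<^sup>2)" and [measurable]: "f \<in> borel_measurable borel"
    using f2 by (auto simp: in_L2_def)
  have gi: "integrable lborel (\<lambda>x. (norm (g x))\<^sup>2)" and [measurable]: "g \<in> borel_measurable borel"
    using g by (auto simp: in_L2_def fourier_L2_def)
  define u where "u R = (\<lambda>x. indicator (cball 0 R) x *\<^sub>R f x)" for R :: real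
  define d where "d R = (\<integral>\<^sup>+ \<xi>. ennreal ((norm (fourier (u R) \<xi> - g \<xi>))\<^sup>2) \<partial>lborel)" for R
  have [measurable]: "cball 0 R \<in> sets (borel :: (real ^ 'n) measure)" for R :: real
    by (simp add: borel_closed)
  have [measurable]: "u R \<in> borel_measurable borel" for R
    unfolding u_def by measurable
  have "(d \<longlongrightarrow> 0) at_top"
    using g unfolding fourier_L2_def d_def u_def by simp
  then have lim: "((\<lambda>R. 2 * ennreal (LINT x|lborel. (norm (f x))\<^sup>2) + 2 * d R) \<longlongrightarrow> 2 * ennreal (LINT x|lborel. (norm (f x))\<^sup>2) + 2 * 0) at_top"
    by (intro tendsto_intros) auto
  have "ennreal (LINT x|lborel. (norm (g x))\<^sup>2) \<le> 2 * ennreal (LINT x|lborel. (norm (f x))\<^sup>2) + 2 * d R" for R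
  proof -
    \<comment> \<open>Majorant for the truncation: y \<le> 1 + y^2 on the ball, whose volume is
      finite.\<close>
    have "integrable lborel (\<lambda>x. indicat_real (cball 0 R) x + (norm (f x))\<^sup>2)"
      using emeasure_bounded_finite[OF bounded_cball[of 0 R]]
      by (intro Bochner_Integration.integrable_add fi integrable_real_indicator) auto
    then have uI: "integrable lborel (u R)"
    proof (rule Bochner_Integration.integrable_bound)
      have "y \<le> 1 + y\<^sup>2" if "y \<ge> 0" for y :: real
        using sum_squares_bound[of y 1] that by simp
      then show "AE x in lborel. norm (u R x) \<le> norm (indicat_real (cball 0 R) x + (norm (f x))\<^sup>2)"
        by (auto simp: u_def indicator_def)
    qed measurable
    have u2: "integrable lborel (\<lambda>x. (norm (u R x))\<^sup>2)"
      by (rule Bochner_Integration.integrable_bound[OF fi]) (auto simp: u_def indicator_def)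
    have "(\<integral>\<^sup>+\<xi>. ennreal ((norm (g \<xi>))\<^sup>2) \<partial>lborel)
      \<le> (\<integral>\<^sup>+\<xi>. 2 * ennreal ((norm (fourier (u R) \<xi>))\<^sup>2) + 2 * ennreal ((norm (fourier (u R) \<xi> - g \<xi>))\<^sup>2) \<partial>lborel)"
    proof (intro nn_integral_mono)
      fix \<xi>
      let ?a = "norm (fourier (u R) \<xi>)" and ?b = "norm (fourier (u R) \<xi> - g \<xi>)"
      have "norm (g \<xi>) \<le> ?a + ?b"
        by (metis norm_triangle_sub add.commute norm_minus_commute)
      then have "(norm (g \<xi>))\<^sup>2 \<le> (?a + ?b)\<^sup>2"
        by (intro power_mono) auto
      also have "\<dots> \<le> 2 * ?a\<^sup>2 + 2 * ?b\<^sup>2"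
        using sum_squares_bound[of ?a ?b] by (simp add: power2_sum)
      finally have "ennreal ((norm (g \<xi>))\<^sup>2) \<le> ennreal (2 * ?a\<^sup>2 + 2 * ?b\<^sup>2)"
        by (rule ennreal_leI)
      then show "ennreal ((norm (g \<xi>))\<^sup>2) \<le> 2 * ennreal (?a\<^sup>2) + 2 * ennreal (?b\<^sup>2)"
        by (simp add: ennreal_mult)
    qed
    also have "\<dots> = 2 * (\<integral>\<^sup>+\<xi>. ennreal ((norm (fourier (u R) \<xi>))\<^sup>2) \<partial>lborel) + 2 * d R"
      unfolding d_def by (subst nn_integral_add) (auto simp: nn_integral_cmult)
    also have "(\<integral>\<^sup>+\<xi>. ennreal ((norm (fourier (u R) \<xi>))\<^sup>2) \<partial>lborel) \<le> ennreal (LINT x|lborel. (norm (u R x))\<^sup>2)"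
      by (rule nn_integral_fourier_power2_le[OF uI u2])
    also have "(LINT x|lborel. (norm (u R x))\<^sup>2) \<le> (LINT x|lborel. (norm (f x))\<^sup>2)"
      by (intro integral_mono u2 fi) (auto simp: u_def indicator_def)
    finally show ?thesis
      using gi by (simp add: nn_integral_eq_integral mult_left_mono add_right_mono ennreal_leI)
  qed
  then have "ennreal (LINT x|lborel. (norm (g x))\<^sup>2) \<le> 2 * ennreal (LINT x|lborel. (norm (f x))\<^sup>2) + 2 * 0"
    by (intro tendsto_lowerbound[OF lim]) auto
  also have "\<dots> = ennreal (2 * (LINT x|lborel. (norm (f x))\<^sup>2))"
    by (simp add: ennreal_mult)
  finally show ?thesis
    unfolding L2_norm_def by (simp add: ennreal_le_iff)
qed

section \<open>Oscillatory integrals with a radial phase\<close>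

text \<open>On a half-line \<open>{..a}\<close> the left side is the volume of a ball and the right
  side is the integral of its derivative in the radius. Half-lines are stable under intersection and
  generate the Borel sets, so the measures agree.\<close>

lemma distr_lborel_norm:
  "distr lborel borel (norm :: 'a::euclidean_space \<Rightarrow> real)
    = density lborel (\<lambda>r. ennreal (real DIM('a) * unit_ball_vol (real DIM('a)) * r ^ (DIM('a) - 1)) * indicator {0..} r)"
    (is "?M = ?N")
proof (rule measure_eqI_generator_eq_countable[where E = "range atMost" and \<Omega> = UNIV and A = "range (\<lambda>n::nat. {..real n})"])
  let ?d = "DIM('a)"
  let ?V = "unit_ball_vol (real ?d)"
  have M: "emeasure ?M {..a} = ennreal (if a \<ge> 0 then ?V * a ^ ?d else 0)" for a
  proof -
    have "emeasure ?M {..a} = emeasure lborel (cball (0::'a) a)"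
      by (subst emeasure_distr) (auto simp: cball_def intro!: arg_cong[where f = "emeasure lborel"])
    then show ?thesis
      by (auto simp: emeasure_cball)
  qed
  have N: "emeasure ?N {..a} = ennreal (if a \<ge> 0 then ?V * a ^ ?d else 0)" for a
  proof -
    have "emeasure ?N {..a} = (\<integral>\<^sup>+r. ennreal (real ?d * ?V * r ^ (?d - 1)) * indicator {0..a} r \<partial>lborel)"
      by (subst emeasure_density) (auto simp: indicator_def intro!: nn_integral_cong)
    also have "\<dots> = ennreal (if a \<ge> 0 then ?V * a ^ ?d else 0)"
    proof (cases "a \<ge> 0")
      case True
      have "(\<integral>\<^sup>+r. ennreal (real ?d * ?V * r ^ (?d - 1)) * indicator {0..a} r \<partial>lborel) = ennreal (?V * a ^ ?d - ?V * 0 ^ ?d)"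
        using True by (intro nn_integral_FTC_Icc) (auto intro!: derivative_eq_intros)
      then show ?thesis
        using True by simp
    qed auto
    finally show ?thesis .
  qed
  show "emeasure ?M X = emeasure ?N X" if "X \<in> range atMost" for X
    using that M N by auto
  show "Int_stable (range atMost :: real set set)"
    by (auto simp: Int_stable_def)
  show "sets ?M = sigma_sets UNIV (range atMost)" "sets ?N = sigma_sets UNIV (range atMost)"
    by (simp_all add: borel_eq_atMost)
  show "\<Union> (range (\<lambda>n::nat. {..real n})) = UNIV"
    using real_arch_simple by auto
  show "emeasure ?M X \<noteq> \<infinity>" if "X \<in> range (\<lambda>n::nat. {..real n})" for X
    using that M by auto
qed auto

text \<open>Polar coordinates turn the integral into that of r^(d - 1 + p) over [0, 1], whose
  exponent exceeds -1 exactly when p > -d. This controls the low frequencies later.\<close>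

lemma integrable_norm_powr_cball:
  assumes p: "p > - real DIM('a::euclidean_space)"
  shows "integrable lborel (\<lambda>x::'a. indicator (cball 0 1) x * norm x powr p)"
proof (rule integrableI_bounded)
  let ?d = "DIM('a)"
  let ?V = "unit_ball_vol (real ?d)"
  have d: "?d > 0" by simp
  have V: "?V \<ge> 0" by simp
  have [measurable]: "cball 0 1 \<in> sets (borel :: 'a measure)"
    by (simp add: borel_closed)
  show "(\<lambda>x::'a. indicator (cball 0 1) x * norm x powr p) \<in> borel_measurable lborel"
    by measurable
  have "(\<integral>\<^sup>+x. ennreal (norm (indicator (cball (0::'a) 1) x * norm x powr p)) \<partial>lborel)
    = (\<integral>\<^sup>+x. ennreal (indicator {..1} (norm x) * norm (x::'a) powr p) \<partial>lborel)"
    by (intro nn_integral_cong) (auto simp: indicator_def)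
  also have "\<dots> = (\<integral>\<^sup>+r. ennreal (indicator {..1} r * r powr p) \<partial>distr lborel borel (norm :: 'a \<Rightarrow> real))"
    by (subst nn_integral_distr) auto
  also have "\<dots> = (\<integral>\<^sup>+r. ennreal (real ?d * ?V * r ^ (?d - 1)) * indicator {0..} r * ennreal (indicator {..1} r * r powr p) \<partial>lborel)"
    unfolding distr_lborel_norm by (subst nn_integral_density) auto
  also have "\<dots> = (\<integral>\<^sup>+r. ennreal (real ?d * ?V) * (ennreal (r powr (real ?d - 1 + p)) * indicator {0..1} r) \<partial>lborel)"
  proof (rule nn_integral_cong_AE)
    have "AE r in lborel. r \<noteq> (0::real)"
      by (rule AE_lborel_singleton)
    then show "AE r in lborel. ennreal (real ?d * ?V * r ^ (?d - 1)) * indicator {0..} r * ennreal (indicator {..1} r * r powr p)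
        = ennreal (real ?d * ?V) * (ennreal (r powr (real ?d - 1 + p)) * indicator {0..1} r)"
    proof eventually_elim
      case (elim r)
      show ?case
      proof (cases "0 < r \<and> r \<le> 1")
        case True
        then have "r ^ (?d - 1) * r powr p = r powr (real ?d - 1 + p)"
          using d by (simp add: powr_add powr_realpow[symmetric] of_nat_diff Suc_leI)
        then show ?thesis
          using True V by (simp add: ennreal_mult[symmetric] mult.assoc)
      qed (use elim in \<open>auto simp: indicator_def\<close>)
    qed
  qed
  also have "\<dots> = ennreal (real ?d * ?V) * (\<integral>\<^sup>+r. ennreal (r powr (real ?d - 1 + p)) * indicator {0..1} r \<partial>lborel)"
    by (rule nn_integral_cmult) auto
  also have "\<dots> < \<infinity>"
  proof -
    have "((\<lambda>r. r powr (real ?d - 1 + p)) has_integral (1 powr (real ?d - 1 + p + 1) / (real ?d - 1 + p + 1))) {0..1}"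
      using p by (intro has_integral_powr_from_0) auto
    then have "(\<integral>\<^sup>+r. ennreal (r powr (real ?d - 1 + p)) * indicator {0..1} r \<partial>lborel) = ennreal (1 powr (real ?d - 1 + p + 1) / (real ?d - 1 + p + 1))"
      by (intro nn_integral_has_integral_lebesgue') auto
    then show ?thesis
      by (simp add: ennreal_mult_less_top)
  qed
  finally show "(\<integral>\<^sup>+x. ennreal (norm (indicator (cball (0::'a) 1) x * norm x powr p)) \<partial>lborel) < \<infinity>" .
qed

section \<open>The Riemann-Lebesgue lemma on the line\<close>

text \<open>Decay passes to dominated pointwise limits: replacing \<open>f\<close> by
  \<open>s i\<close> changes the integral by at most the L^1 distance, uniformly in
  \<open>t\<close>. The three later uses are countable disjoint unions, truncations of a set, and
  limits of simple functions.\<close>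

lemma oscillating_integral_dominated:
  fixes f :: "real \<Rightarrow> real"
  assumes s: "\<And>i. s i \<in> borel_measurable lborel"
    and f: "f \<in> borel_measurable lborel" and w: "integrable lborel w"
    and lim: "\<And>x. (\<lambda>i::nat. s i x) \<longlonglongrightarrow> f x" and bd: "\<And>i x. \<bar>s i x\<bar> \<le> w x"
    and s0: "\<And>i. ((\<lambda>t. LINT r|lborel. s i r *\<^sub>R cis (t * r)) \<longlongrightarrow> 0) at_top"
  shows "((\<lambda>t. LINT r|lborel. f r *\<^sub>R cis (t * r)) \<longlongrightarrow> 0) at_top"
proof (rule tendstoI)
  fix e :: real assume e: "e > 0"
  note [measurable] = s f borel_measurable_integrable[OF w]
  have bdf: "\<bar>f x\<bar> \<le> w x" for x
    by (rule LIMSEQ_le_const2[OF tendsto_rabs[OF lim]]) (use bd in auto)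
  have si: "integrable lborel (s i)" for i
    by (rule Bochner_Integration.integrable_bound[OF w]) (auto intro!: order_trans[OF bd])
  have fi: "integrable lborel f"
    by (rule Bochner_Integration.integrable_bound[OF w]) (auto intro!: order_trans[OF bdf])
  have "(\<lambda>i. LINT x|lborel. \<bar>s i x - f x\<bar>) \<longlonglongrightarrow> (LINT x|lborel. \<bar>f x - f x\<bar>)"
  proof (rule integral_dominated_convergence[where w = "\<lambda>x. 2 * w x"])
    show "AE x in lborel. (\<lambda>i. \<bar>s i x - f x\<bar>) \<longlonglongrightarrow> \<bar>f x - f x\<bar>"
      by (intro AE_I2 tendsto_intros lim)
    have "\<bar>s i x - f x\<bar> \<le> 2 * w x" for i x
      using bd[of i x] bdf[of x] by linarith
    then show "AE x in lborel. norm \<bar>s i x - f x\<bar> \<le> 2 * w x" for i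
      by simp
  qed (use w in auto)
  then have "(\<lambda>i. LINT x|lborel. \<bar>s i x - f x\<bar>) \<longlonglongrightarrow> 0"
    by simp
  then obtain i where i: "(LINT x|lborel. \<bar>s i x - f x\<bar>) < e / 2"
    using e by (metis (mono_tags, lifting) eventually_sequentially half_gt_zero_iff order_refl order_tendstoD(2))
  have "\<forall>\<^sub>F t in at_top. norm (LINT r|lborel. s i r *\<^sub>R cis (t * r)) < e / 2"
    using tendstoD[OF s0[of i], of "e / 2"] e by simp
  then show "\<forall>\<^sub>F t in at_top. dist (LINT r|lborel. f r *\<^sub>R cis (t * r)) 0 < e"
  proof eventually_elim
    case (elim t)
    have ic: "integrable lborel (\<lambda>r. g r *\<^sub>R cis (t * r))" if g: "integrable lborel g" for g :: "real \<Rightarrow> real"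
      using borel_measurable_integrable[OF g]
      by (intro Bochner_Integration.integrable_bound[OF g]) auto
    have "(LINT r|lborel. f r *\<^sub>R cis (t * r))
        = (LINT r|lborel. s i r *\<^sub>R cis (t * r)) - (LINT r|lborel. (s i r - f r) *\<^sub>R cis (t * r))"
      unfolding scaleR_diff_left by (subst Bochner_Integration.integral_diff[OF ic[OF si] ic[OF fi]]) simp
    also have "norm \<dots> \<le> norm (LINT r|lborel. s i r *\<^sub>R cis (t * r)) + norm (LINT r|lborel. (s i r - f r) *\<^sub>R cis (t * r))"
      by (rule norm_triangle_ineq4)
    also have "norm (LINT r|lborel. (s i r - f r) *\<^sub>R cis (t * r)) \<le> (LINT r|lborel. norm ((s i r - f r) *\<^sub>R cis (t * r)))"
      by (rule integral_norm_bound)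
    also have "\<dots> = (LINT x|lborel. \<bar>s i x - f x\<bar>)"
      by simp
    finally show ?case
      using i elim by simp
  qed
qed

text \<open>The explicit antiderivative of the character has modulus 1 / t, which gives the bound 2
  / t.\<close>

lemma oscillating_integral_Icc:
  fixes a b :: real
  shows "((\<lambda>t. LINT r|lborel. indicator {a..b} r *\<^sub>R cis (t * r)) \<longlongrightarrow> 0) at_top"
proof (cases "a \<le> b")
  case True
  have bound: "norm (LINT r|lborel. indicator {a..b} r *\<^sub>R cis (t * r)) \<le> 2 / t" if t: "t > 0" for t
  proof -
    have "(LINT r|lborel. indicator {a..b} r *\<^sub>R cis (t * r)) = - \<i> / of_real t * cis (t * b) - - \<i> / of_real t * cis (t * a)"
    proof (rule integral_FTC_Icc[OF True])
      show "((\<lambda>r. - \<i> / of_real t * cis (t * r)) has_vector_derivative cis (t * x)) (at x within {a..b})" for x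
        unfolding cis_conv_exp using t
        by (auto intro!: derivative_eq_intros has_vector_derivative_real_field simp: field_simps)
    qed (intro continuous_intros)
    also have "norm \<dots> \<le> norm (- \<i> / of_real t * cis (t * b)) + norm (- \<i> / of_real t * cis (t * a))"
      by (rule norm_triangle_ineq4)
    also have "\<dots> = 2 / t"
      using t by (simp add: norm_mult norm_divide)
    finally show ?thesis .
  qed
  show ?thesis
  proof (rule Lim_null_comparison)
    show "\<forall>\<^sub>F t in at_top. norm (LINT r|lborel. indicator {a..b} r *\<^sub>R cis (t * r)) \<le> 2 / t"
      using eventually_gt_at_top[of 0] by eventually_elim (rule bound)
    show "((\<lambda>t::real. 2 / t) \<longlongrightarrow> 0) at_top"
      by (rule tendsto_divide_0[OF tendsto_const filterlim_at_top_imp_at_infinity[OF filterlim_ident]])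
  qed
qed auto

text \<open>Induction over the Borel sets generated by half-lines, an intersection-stable family.
  Intersecting with \<open>{- m..m}\<close> keeps every indicator integrable and makes the
  complement a difference from the interval case.\<close>

lemma oscillating_integral_bounded_set:
  fixes A :: "real set"
  assumes "A \<in> sets borel"
  shows "((\<lambda>t. LINT r|lborel. indicator (A \<inter> {- m..m}) r *\<^sub>R cis (t * r)) \<longlongrightarrow> 0) at_top"
proof -
  let ?I = "{- m..m}"
  have mA: "A \<in> sets borel" if "A \<in> sigma_sets UNIV (range atMost)" for A :: "real set"
    using that by (simp add: borel_eq_atMost)
  have I: "integrable lborel (indicat_real ?I)"
    by (rule integrable_real_indicator) (auto simp: emeasure_lborel_Icc_eq)
  have ind: "integrable lborel (\<lambda>r. indicat_real (A \<inter> ?I) r *\<^sub>R cis (t * r))" if [measurable]: "A \<in> sets borel" for A t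
    by (rule Bochner_Integration.integrable_bound[OF I]) (auto simp: indicator_def)
  have "Int_stable (range atMost :: real set set)"
    by (auto simp: Int_stable_def)
  moreover have "range atMost \<subseteq> Pow (UNIV :: real set)"
    by simp
  moreover have "A \<in> sigma_sets UNIV (range atMost)"
    using assms by (simp add: borel_eq_atMost)
  ultimately show ?thesis
  proof (induction rule: sigma_sets_induct_disjoint)
    case (basic A)
    then obtain a where "A = {..a}" by auto
    then have "A \<inter> ?I = {- m..min a m}" by auto
    then show ?case using oscillating_integral_Icc by simp
  next
    case (compl A)
    have "(\<lambda>r. indicat_real ((UNIV - A) \<inter> ?I) r *\<^sub>R cis (t * r))
      = (\<lambda>r. indicat_real (UNIV \<inter> ?I) r *\<^sub>R cis (t * r) - indicat_real (A \<inter> ?I) r *\<^sub>R cis (t * r))" for t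
      by (auto simp: indicator_def)
    then have "(LINT r|lborel. indicat_real ((UNIV - A) \<inter> ?I) r *\<^sub>R cis (t * r))
      = (LINT r|lborel. indicat_real (UNIV \<inter> ?I) r *\<^sub>R cis (t * r)) - (LINT r|lborel. indicat_real (A \<inter> ?I) r *\<^sub>R cis (t * r))" for t
      using ind[OF mA[OF compl(1)], of t] ind[of UNIV t] by simp
    then show ?case
      using tendsto_diff[OF oscillating_integral_Icc[of "- m" m] compl(2)] by simp
  next
    case (union A)
    have [measurable]: "A i \<in> sets borel" for i
      using union(2) mA by auto
    show ?case
    proof (rule oscillating_integral_dominated[where s = "\<lambda>n r. \<Sum>i<n. indicat_real (A i \<inter> ?I) r" and w = "indicat_real ?I"])
      \<comment> \<open>Disjointness turns the partial sum into the indicator of a finite union,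
        hence bounded by the indicator of \<open>?I\<close>.\<close>
      have s: "(\<Sum>i<n. indicat_real (A i \<inter> ?I) r) = indicat_real (\<Union>i<n. A i) r * indicat_real ?I r" for n r
        using union(1) unfolding indicator_inter_arith sum_distrib_right[symmetric]
        by (subst indicator_UN_disjoint) (auto simp: disjoint_family_on_def)
      show "(\<lambda>n. \<Sum>i<n. indicat_real (A i \<inter> ?I) r) \<longlonglongrightarrow> indicat_real (\<Union> (range A) \<inter> ?I) r" for r
        unfolding s unfolding indicator_inter_arith by (intro tendsto_mult tendsto_const LIMSEQ_indicator_UN)
      show "\<bar>\<Sum>i<n. indicat_real (A i \<inter> ?I) r\<bar> \<le> indicat_real ?I r" for n r
        unfolding s by (auto simp: indicator_def)
      show "((\<lambda>t. LINT r|lborel. (\<Sum>i<n. indicat_real (A i \<inter> ?I) r) *\<^sub>R cis (t * r)) \<longlongrightarrow> 0) at_top" for n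
      proof -
        have "((\<lambda>t. \<Sum>i<n. LINT r|lborel. indicat_real (A i \<inter> ?I) r *\<^sub>R cis (t * r)) \<longlongrightarrow> (\<Sum>i<n. 0)) at_top"
          by (intro tendsto_sum union(3))
        moreover have "(LINT r|lborel. (\<Sum>i<n. indicat_real (A i \<inter> ?I) r) *\<^sub>R cis (t * r))
          = (\<Sum>i<n. LINT r|lborel. indicat_real (A i \<inter> ?I) r *\<^sub>R cis (t * r))" for t
          unfolding scaleR_sum_left by (rule Bochner_Integration.integral_sum) (auto intro: ind)
        ultimately show ?thesis
          by simp
      qed
      show "(\<lambda>r. \<Sum>i<n. indicat_real (A i \<inter> ?I) r) \<in> borel_measurable lborel" for n
        by measurable
      show "indicat_real (\<Union> (range A) \<inter> ?I) \<in> borel_measurable lborel"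
        by measurable
    qed (rule I)
  qed simp
qed

text \<open>Standard induction on integrable functions. A set of finite measure may be unbounded, so
  the base case approximates it by its intersections with \<open>{- real n..real n}\<close>.\<close>

lemma Riemann_Lebesgue:
  fixes f :: "real \<Rightarrow> real"
  assumes "integrable lborel f"
  shows "((\<lambda>t. LINT r|lborel. f r *\<^sub>R cis (t * r)) \<longlongrightarrow> 0) at_top"
  using assms
proof (induction rule: integrable_induct)
  case (base A c)
  then have [measurable]: "A \<in> sets borel" by simp
  have w: "integrable lborel (\<lambda>r. indicat_real A r * \<bar>c\<bar>)"
    using base by (intro integrable_mult_left integrable_real_indicator) auto
  show ?case
  proof (rule oscillating_integral_dominated[where s = "\<lambda>n r. indicat_real (A \<inter> {- real n..real n}) r *\<^sub>R c" and w = "\<lambda>r. indicat_real A r * \<bar>c\<bar>"])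
    show "(\<lambda>n. indicat_real (A \<inter> {- real n..real n}) r *\<^sub>R c) \<longlonglongrightarrow> indicat_real A r *\<^sub>R c" for r
    proof (rule tendsto_eventually)
      have "\<forall>\<^sub>F n in sequentially. real n \<ge> \<bar>r\<bar>"
        using eventually_ge_at_top[of "nat \<lceil>\<bar>r\<bar>\<rceil>"] by eventually_elim linarith
      then show "\<forall>\<^sub>F n in sequentially. indicat_real (A \<inter> {- real n..real n}) r *\<^sub>R c = indicat_real A r *\<^sub>R c"
        by eventually_elim (auto simp: indicator_def)
    qed
    show "((\<lambda>t. LINT r|lborel. (indicat_real (A \<inter> {- real n..real n}) r *\<^sub>R c) *\<^sub>R cis (t * r)) \<longlongrightarrow> 0) at_top" for n
    proof -
      have "(LINT r|lborel. (indicat_real (A \<inter> {- real n..real n}) r *\<^sub>R c) *\<^sub>R cis (t * r))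
        = c *\<^sub>R (LINT r|lborel. indicat_real (A \<inter> {- real n..real n}) r *\<^sub>R cis (t * r))" for t
        by (subst integral_scaleR_right[symmetric]) (simp add: mult.commute)
      then show ?thesis
        using tendsto_scaleR[OF tendsto_const[of c] oscillating_integral_bounded_set[of A "real n"]] by simp
    qed
    show "(\<lambda>r. indicat_real (A \<inter> {- real n..real n}) r *\<^sub>R c) \<in> borel_measurable lborel" for n
      by measurable
    show "(\<lambda>r. indicat_real A r *\<^sub>R c) \<in> borel_measurable lborel"
      by measurable
    show "\<bar>indicat_real (A \<inter> {- real n..real n}) r *\<^sub>R c\<bar> \<le> indicat_real A r * \<bar>c\<bar>" for n r
      by (auto simp: indicator_def)
  qed (rule w)
next
  case (add f g)
  have ic: "integrable lborel (\<lambda>r. g r *\<^sub>R cis (t * r))" if g: "integrable lborel g" for g :: "real \<Rightarrow> real" and t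
    using borel_measurable_integrable[OF g]
    by (intro Bochner_Integration.integrable_bound[OF g]) auto
  show ?case
    unfolding scaleR_add_left Bochner_Integration.integral_add[OF ic[OF add.hyps(1)] ic[OF add.hyps(2)]]
    using tendsto_add[OF add.IH] by (simp only: add_0)
next
  case (lim f s)
  show ?case
  proof (rule oscillating_integral_dominated[where s = s and w = "\<lambda>r. 2 * \<bar>f r\<bar>"])
    show "s i \<in> borel_measurable lborel" for i
      using lim.hyps(1) by (rule borel_measurable_integrable)
    show "f \<in> borel_measurable lborel"
      using lim.hyps(4) by (rule borel_measurable_integrable)
    show "integrable lborel (\<lambda>r. 2 * \<bar>f r\<bar>)"
      using lim.hyps(4) by (intro integrable_mult_right integrable_abs)
    show "(\<lambda>i. s i x) \<longlonglongrightarrow> f x" for x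
      by (rule lim.hyps(2)) simp
    show "\<bar>s i x\<bar> \<le> 2 * \<bar>f x\<bar>" for i x
      using lim.hyps(3)[of x i] by simp
  qed (rule lim.IH)
qed

text \<open>The image of \<open>g dx\<close> under the norm is absolutely continuous, so its Radon--Nikodym density
  reduces the claim to one dimension.\<close>

lemma oscillating_integral_norm:
  fixes g :: "'a::euclidean_space \<Rightarrow> real"
  assumes g: "integrable lborel g"
  shows "((\<lambda>t. LINT x|lborel. g x *\<^sub>R cis (t * norm x)) \<longlongrightarrow> 0) at_top"
proof -
  \<comment> \<open>Nonnegative functions come first, so that \<open>h\<close> is the density of a
    measure; the general case follows from the positive and negative parts.\<close>
  have pos: "((\<lambda>t. LINT x|lborel. h x *\<^sub>R cis (t * norm x)) \<longlongrightarrow> 0) at_top"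
    if h: "integrable lborel h" and h0: "\<And>x. h x \<ge> 0" for h :: "'a \<Rightarrow> real"
  proof -
    have [measurable]: "h \<in> borel_measurable borel" using h by auto
    define N where "N = distr (density lborel h) borel (norm :: 'a \<Rightarrow> real)"
    have sN: "sets N = sets lborel" by (simp add: N_def)
    have nA: "norm -` A \<in> sets (borel :: 'a measure)" if "A \<in> sets borel" for A :: "real set"
      using measurable_sets[of "norm :: 'a \<Rightarrow> real" borel borel A] that by simp
    have N: "emeasure N A = (\<integral>\<^sup>+x. ennreal (h x) * indicator A (norm x) \<partial>lborel)" if [measurable]: "A \<in> sets borel" for A
      unfolding N_def by (subst emeasure_distr, simp, simp, subst emeasure_density)
        (auto intro!: nn_integral_cong simp: nA[OF that] indicator_def)
    have fin: "finite_measure N"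
    proof
      show "emeasure N (space N) \<noteq> \<infinity>"
        using h h0 by (subst N) (auto simp: N_def nn_integral_eq_integral)
    qed
    \<comment> \<open>By the polar density, a null set of radii has a null preimage under the norm,
      and \<open>h\<close> integrates to 0 over it.\<close>
    have ac: "absolutely_continuous lborel N"
      unfolding absolutely_continuous_def
    proof
      fix A :: "real set" assume A: "A \<in> null_sets lborel"
      then have Ab [measurable]: "A \<in> sets borel" by auto
      have "A \<in> null_sets (distr lborel borel (norm :: 'a \<Rightarrow> real))"
        unfolding distr_lborel_norm using A
        by (subst null_sets_density_iff) (auto intro: eventually_mono[OF AE_not_in])
      then have "emeasure lborel (norm -` A :: 'a set) = 0"
        by (simp add: null_sets_def emeasure_distr)
      moreover have "norm -` A \<in> sets (borel :: 'a measure)"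
        by (rule nA[OF Ab])
      ultimately have "AE x::'a in lborel. x \<notin> norm -` A"
        by (intro AE_not_in) (auto simp: null_sets_def)
      then have "(\<integral>\<^sup>+x. ennreal (h x) * indicator A (norm x) \<partial>lborel) = 0"
        by (subst nn_integral_0_iff_AE) (auto elim!: eventually_mono)
      then show "A \<in> null_sets N"
        using N[OF Ab] Ab by (auto simp: null_sets_def N_def)
    qed
    obtain D where [measurable]: "D \<in> borel_measurable lborel"
      and D: "AE x in lborel. RN_deriv lborel N x = ennreal (D x)" and D0: "\<And>x. 0 \<le> D x"
      using sigma_finite_measure.real_RN_deriv[OF sigma_finite_lborel fin ac sN] by metis
    have ND: "N = density lborel D"
      using sigma_finite_measure.density_RN_deriv[OF sigma_finite_lborel ac sN] density_cong[OF _ _ D] by auto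
    interpret N: finite_measure N by fact
    have "integrable N (\<lambda>x. 1::real)" by simp
    then have "integrable lborel D"
      unfolding ND using D0 by (subst (asm) integrable_density) auto
    moreover have "(LINT x|lborel. h x *\<^sub>R cis (t * norm x)) = (LINT r|lborel. D r *\<^sub>R cis (t * r))" for t
    proof -
      have "(LINT x|lborel. h x *\<^sub>R cis (t * norm x)) = (LINT x|density lborel h. cis (t * norm x))"
        using h0 by (subst integral_density) auto
      also have "\<dots> = (LINT r|N. cis (t * r))"
        unfolding N_def by (subst integral_distr) auto
      also have "\<dots> = (LINT r|lborel. D r *\<^sub>R cis (t * r))"
        unfolding ND using D0 by (subst integral_density) auto
      finally show ?thesis .
    qed
    ultimately show ?thesis
      using Riemann_Lebesgue by simp
  qed
  have i: "integrable lborel (\<lambda>x. max 0 (g x))" "integrable lborel (\<lambda>x. max 0 (- g x))"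
    using g by auto
  have ic: "integrable lborel (\<lambda>x. h x *\<^sub>R cis (t * norm x))" if h: "integrable lborel h" for h :: "'a \<Rightarrow> real" and t
    using borel_measurable_integrable[OF h]
    by (intro Bochner_Integration.integrable_bound[OF h]) auto
  have "(LINT x|lborel. g x *\<^sub>R cis (t * norm x))
    = (LINT x|lborel. max 0 (g x) *\<^sub>R cis (t * norm x)) - (LINT x|lborel. max 0 (- g x) *\<^sub>R cis (t * norm x))" for t
    by (subst Bochner_Integration.integral_diff[OF ic[OF i(1)] ic[OF i(2)], symmetric])
       (auto intro!: Bochner_Integration.integral_cong simp: scaleR_diff_left[symmetric] max_def)
  then show ?thesis
    using tendsto_diff[OF pos[OF i(1)] pos[OF i(2)]] by simp
qed

section \<open>The limit of oscillating L^2 norms\<close>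

lemma oscillating_L2_limit:
  fixes a b :: "'a::euclidean_space \<Rightarrow> complex"
  assumes [measurable]: "a \<in> borel_measurable borel" "b \<in> borel_measurable borel"
    and a: "integrable lborel (\<lambda>x. (norm (a x))\<^sup>2)" and b: "integrable lborel (\<lambda>x. (norm (b x))\<^sup>2)"
  shows "((\<lambda>t. LINT x|lborel. (norm (cos (norm x * t) *\<^sub>R a x + sin (norm x * t) *\<^sub>R b x))\<^sup>2)
    \<longlongrightarrow> ((LINT x|lborel. (norm (a x))\<^sup>2) + (LINT x|lborel. (norm (b x))\<^sup>2)) / 2) at_top"
proof -
  \<comment> \<open>By the double-angle formulas (see \<open>pt\<close>), \<open>p\<close> and
    \<open>q\<close> are the coefficients of the cosine and sine of 2 |x| t; \<open>q\<close> is the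
    real part of a * \<open>cnj b\<close>.\<close>
  define p where "p x = ((norm (a x))\<^sup>2 - (norm (b x))\<^sup>2) / 2" for x
  define q where "q x = Re (a x) * Re (b x) + Im (a x) * Im (b x)" for x
  let ?S = "\<lambda>x. ((norm (a x))\<^sup>2 + (norm (b x))\<^sup>2) / 2"
  have S: "integrable lborel ?S" and p: "integrable lborel p"
    unfolding p_def using a b by auto
  have "\<bar>q x\<bar> \<le> norm (?S x)" for x
  proof -
    have "\<bar>q x\<bar> \<le> norm (a x) * norm (b x)"
      using abs_Re_le_cmod[of "a x * cnj (b x)"] by (simp add: q_def norm_mult)
    then show ?thesis
      using sum_squares_bound[of "norm (a x)" "norm (b x)"] by simp
  qed
  then have q: "integrable lborel q"
    unfolding q_def by (intro Bochner_Integration.integrable_bound[OF S]) auto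
  have ic: "integrable lborel (\<lambda>x. h x *\<^sub>R cis (t * norm x))" if h: "integrable lborel h" for h :: "'a \<Rightarrow> real" and t
    using borel_measurable_integrable[OF h]
    by (intro Bochner_Integration.integrable_bound[OF h]) auto
  have pt: "(norm (cos r *\<^sub>R z + sin r *\<^sub>R w))\<^sup>2
    = ((norm z)\<^sup>2 + (norm w)\<^sup>2) / 2 + (((norm z)\<^sup>2 - (norm w)\<^sup>2) / 2 * cos (2 * r) + Re (z * cnj w) * sin (2 * r))"
    for r :: real and z w :: complex
  proof -
    have "(norm (cos r *\<^sub>R z + sin r *\<^sub>R w))\<^sup>2
      = (cos r)\<^sup>2 * (norm z)\<^sup>2 + (sin r)\<^sup>2 * (norm w)\<^sup>2 + 2 * (sin r * cos r) * Re (z * cnj w)"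
      unfolding cmod_power2 by (simp add: power2_eq_square algebra_simps)
    then show ?thesis
      unfolding cos_double sin_double cos_squared_eq by (simp add: field_simps)
  qed
  have eq: "(LINT x|lborel. (norm (cos (norm x * t) *\<^sub>R a x + sin (norm x * t) *\<^sub>R b x))\<^sup>2)
    = (LINT x|lborel. ?S x) + (Re (LINT x|lborel. p x *\<^sub>R cis (2 * t * norm x)) + Im (LINT x|lborel. q x *\<^sub>R cis (2 * t * norm x)))" for t
  proof -
    have "(LINT x|lborel. (norm (cos (norm x * t) *\<^sub>R a x + sin (norm x * t) *\<^sub>R b x))\<^sup>2)
      = (LINT x|lborel. ?S x + (Re (p x *\<^sub>R cis (2 * t * norm x)) + Im (q x *\<^sub>R cis (2 * t * norm x))))"
      unfolding pt by (simp add: p_def q_def mult_ac)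
    also have "\<dots> = (LINT x|lborel. ?S x) + ((LINT x|lborel. Re (p x *\<^sub>R cis (2 * t * norm x))) + (LINT x|lborel. Im (q x *\<^sub>R cis (2 * t * norm x))))"
      using S integrable_Re[OF ic[OF p]] integrable_Im[OF ic[OF q]]
      by (subst Bochner_Integration.integral_add; (subst Bochner_Integration.integral_add)?) auto
    finally show ?thesis
      unfolding integral_Re[OF ic[OF p]] integral_Im[OF ic[OF q]] .
  qed
  have "filterlim (\<lambda>t::real. 2 * t) at_top at_top"
    by (intro filterlim_tendsto_pos_mult_at_top[OF tendsto_const] filterlim_ident) auto
  note lim = filterlim_compose[OF oscillating_integral_norm[OF p] this]
    filterlim_compose[OF oscillating_integral_norm[OF q] this]
  have "((\<lambda>t. (LINT x|lborel. ?S x) + (Re (LINT x|lborel. p x *\<^sub>R cis (2 * t * norm x)) + Im (LINT x|lborel. q x *\<^sub>R cis (2 * t * norm x))))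
    \<longlongrightarrow> (LINT x|lborel. ?S x) + (Re 0 + Im 0)) at_top"
    by (intro tendsto_intros lim)
  then show ?thesis
    unfolding eq using a b by simp
qed

section \<open>Vanishing moments\<close>

lemma mi_power_bound: "\<bar>mi_power x \<beta>\<bar> \<le> norm x ^ mi_order \<beta>"
proof -
  have "\<bar>mi_power x \<beta>\<bar> = (\<Prod>i\<in>UNIV. \<bar>x $ i\<bar> ^ \<beta> i)"
    by (simp add: mi_power_def abs_prod power_abs)
  also have "\<dots> \<le> (\<Prod>i\<in>UNIV. norm x ^ \<beta> i)"
    by (intro prod_mono conjI power_mono component_le_norm_cart) auto
  finally show ?thesis
    by (simp add: mi_order_def power_sum)
qed

lemma borel_measurable_mi_power [measurable]: "(\<lambda>x. mi_power x \<beta>) \<in> borel_measurable borel"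
  unfolding mi_power_def by measurable

lemma mi_power_upd_Suc:
  "mi_power x (\<beta>(i := Suc (\<beta> i))) = x $ i * mi_power x \<beta>"
  "mi_order (\<beta>(i := Suc (\<beta> i))) = Suc (mi_order \<beta>)"
  by (simp_all add: mi_power_def mi_order_def prod.remove[of UNIV i] sum.remove[of UNIV i])

text \<open>Instead of a multinomial expansion, one factor \<open>x \<bullet> \<xi>\<close> at a
  time is written as a sum over coordinates, and each coordinate is absorbed into the multi-index.
  The factor \<open>mi_power x \<beta>\<close> is there for this induction, which preserves
  \<open>j + mi_order \<beta>\<close>.\<close>

lemma inner_power_moment_eq_0:
  fixes f :: "real ^ 'n \<Rightarrow> complex"
  assumes f: "\<And>j. j < k \<Longrightarrow> integrable lborel (\<lambda>x. norm x ^ j *\<^sub>R f x)"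
    and fm: "f \<in> borel_measurable borel"
    and m: "\<And>\<alpha>. mi_order \<alpha> < k \<Longrightarrow> moment \<alpha> f = 0"
    and "j + mi_order \<beta> < k"
  shows "(LINT x|lborel. ((x \<bullet> \<xi>) ^ j * mi_power x \<beta>) *\<^sub>R f x) = 0"
  using assms(4)
proof (induction j arbitrary: \<beta>)
  case 0
  then show ?case using m by (simp add: moment_def)
next
  case (Suc j)
  let ?\<beta> = "\<lambda>i. \<beta>(i := Suc (\<beta> i))"
  let ?g = "\<lambda>i x. ((x \<bullet> \<xi>) ^ j * mi_power x (?\<beta> i)) *\<^sub>R f x"
  note [measurable] = fm
  have ord: "j + mi_order (?\<beta> i) < k" for i
    using Suc.prems by (simp add: mi_power_upd_Suc)
  have i: "integrable lborel (?g i)" for i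
  proof (rule Bochner_Integration.integrable_bound)
    show "integrable lborel (\<lambda>x. norm \<xi> ^ j *\<^sub>R (norm x ^ (j + mi_order (?\<beta> i)) *\<^sub>R f x))"
      by (intro integrable_scaleR_right f ord)
    have "\<bar>(x \<bullet> \<xi>) ^ j * mi_power x (?\<beta> i)\<bar> \<le> norm \<xi> ^ j * norm x ^ (j + mi_order (?\<beta> i))" for x
    proof -
      have "\<bar>(x \<bullet> \<xi>) ^ j * mi_power x (?\<beta> i)\<bar> \<le> (norm x * norm \<xi>) ^ j * norm x ^ mi_order (?\<beta> i)"
        unfolding abs_mult power_abs by (intro mult_mono power_mono Cauchy_Schwarz_ineq2 mi_power_bound) auto
      also have "\<dots> = norm \<xi> ^ j * norm x ^ (j + mi_order (?\<beta> i))"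
        by (simp add: power_add power_mult_distrib)
      finally show ?thesis .
    qed
    from mult_right_mono[OF this norm_ge_zero]
    have "norm (?g i x) \<le> norm (norm \<xi> ^ j *\<^sub>R (norm x ^ (j + mi_order (?\<beta> i)) *\<^sub>R f x))" for x
      by (simp add: mult.assoc)
    then show "AE x in lborel. norm (?g i x) \<le> norm (norm \<xi> ^ j *\<^sub>R (norm x ^ (j + mi_order (?\<beta> i)) *\<^sub>R f x))"
      by simp
  qed measurable
  have "((x \<bullet> \<xi>) ^ Suc j * mi_power x \<beta>) *\<^sub>R f x = (\<Sum>i\<in>UNIV. (\<xi> $ i) *\<^sub>R ?g i x)" for x
    unfolding mi_power_upd_Suc inner_vec_def scaleR_scaleR scaleR_sum_left[symmetric]
    by (simp add: sum_distrib_left sum_distrib_right mult_ac)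
  then have "(LINT x|lborel. ((x \<bullet> \<xi>) ^ Suc j * mi_power x \<beta>) *\<^sub>R f x) = (\<Sum>i\<in>UNIV. (\<xi> $ i) *\<^sub>R (LINT x|lborel. ?g i x))"
    by (simp only:) (subst Bochner_Integration.integral_sum; simp add: i del: scaleR_scaleR)
  also have "\<dots> = 0"
    by (intro sum.neutral ballI) (simp only: Suc.IH[OF ord] scaleR_zero_right)
  finally show ?case .
qed

text \<open>After scaling, the Taylor remainder at y / (m + 1) isolates the next Taylor term; the
  error bound one order higher leaves a factor 1 / (m + 1). It serves to read off a moment from the
  Fourier integral near the origin.\<close>

lemma iexp_scaled_remainder_tendsto:
  fixes y :: real
  shows "(\<lambda>m. of_nat (Suc m) ^ Suc n * (iexp (y / real (Suc m)) - (\<Sum>j\<le>n. (\<i> * complex_of_real (y / real (Suc m))) ^ j / fact j)))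
    \<longlonglongrightarrow> (\<i> * y) ^ Suc n / fact (Suc n)"
proof (rule LIM_zero_cancel, rule Lim_null_comparison)
  show "\<forall>\<^sub>F m in sequentially. norm (of_nat (Suc m) ^ Suc n * (iexp (y / real (Suc m)) - (\<Sum>j\<le>n. (\<i> * complex_of_real (y / real (Suc m))) ^ j / fact j))
      - (\<i> * y) ^ Suc n / fact (Suc n)) \<le> \<bar>y\<bar> ^ Suc (Suc n) / fact (Suc (Suc n)) * (1 / real (Suc m))"
  proof (rule always_eventually, rule allI)
    fix m
    let ?M = "real (Suc m)" and ?u = "y / real (Suc m)"
    let ?E = "iexp ?u - (\<Sum>j\<le>Suc n. (\<i> * complex_of_real ?u) ^ j / fact j)"
    have "complex_of_real ?M ^ Suc n * ((\<i> * complex_of_real ?u) ^ Suc n / fact (Suc n)) = (\<i> * y) ^ Suc n / fact (Suc n)"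
      unfolding times_divide_eq_right power_mult_distrib[symmetric] by (simp del: of_nat_Suc power_Suc)
    then have "of_nat (Suc m) ^ Suc n * (iexp ?u - (\<Sum>j\<le>n. (\<i> * complex_of_real ?u) ^ j / fact j))
        - (\<i> * y) ^ Suc n / fact (Suc n) = complex_of_real ?M ^ Suc n * ?E"
      by (simp add: algebra_simps del: of_nat_Suc power_Suc)
    then have "norm (of_nat (Suc m) ^ Suc n * (iexp ?u - (\<Sum>j\<le>n. (\<i> * complex_of_real ?u) ^ j / fact j))
        - (\<i> * y) ^ Suc n / fact (Suc n)) = ?M ^ Suc n * norm ?E"
      by (simp add: norm_mult norm_power del: of_nat_Suc power_Suc)
    also have "\<dots> \<le> ?M ^ Suc n * (\<bar>?u\<bar> ^ Suc (Suc n) / fact (Suc (Suc n)))"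
      by (intro mult_left_mono iexp_approx1) auto
    also have "\<dots> = \<bar>y\<bar> ^ Suc (Suc n) / fact (Suc (Suc n)) * (1 / ?M)"
      by (simp add: power_divide field_simps del: of_nat_Suc fact_Suc)
    finally show "norm (of_nat (Suc m) ^ Suc n * (iexp ?u - (\<Sum>j\<le>n. (\<i> * complex_of_real ?u) ^ j / fact j))
        - (\<i> * y) ^ Suc n / fact (Suc n)) \<le> \<bar>y\<bar> ^ Suc (Suc n) / fact (Suc (Suc n)) * (1 / ?M)" .
  qed
  show "(\<lambda>m. \<bar>y\<bar> ^ Suc (Suc n) / fact (Suc (Suc n)) * (1 / real (Suc m))) \<longlonglongrightarrow> 0"
    by (intro tendsto_mult_right_zero lim_1_over_n[THEN LIMSEQ_Suc])
qed

section \<open>Fourier integrals of functions whose moments up to order \<open>n\<close>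
  vanish\<close>

context
  fixes f :: "real ^ 'n \<Rightarrow> complex" and n :: nat
  assumes f: "integrable lborel f"
    and fk: "integrable lborel (\<lambda>x. norm x ^ Suc n * norm (f x))"
    and vanish: "\<And>\<alpha>. mi_order \<alpha> \<le> n \<Longrightarrow> moment \<alpha> f = 0"
begin

private lemma f_measurable [measurable]: "f \<in> borel_measurable borel"
  using f by auto

lemma integrable_norm_power_le:
  assumes "j \<le> Suc n"
  shows "integrable lborel (\<lambda>x. norm x ^ j *\<^sub>R f x)"
proof (rule Bochner_Integration.integrable_bound)
  show "integrable lborel (\<lambda>x. norm (f x) + norm x ^ Suc n * norm (f x))"
    using f fk by (intro Bochner_Integration.integrable_add integrable_norm)
  have "norm x ^ j \<le> 1 + norm x ^ Suc n" for x :: "real ^ 'n"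
  proof (cases "norm x \<le> 1")
    case True
    then have "norm x ^ j \<le> 1" by (intro power_le_one) auto
    then show ?thesis by (simp add: add_increasing2)
  next
    case False
    then show ?thesis using power_increasing[OF assms, of "norm x"] by simp
  qed
  from mult_right_mono[OF this norm_ge_zero]
  show "AE x in lborel. norm (norm x ^ j *\<^sub>R f x) \<le> norm (norm (f x) + norm x ^ Suc n * norm (f x))"
    by (intro AE_I2) (simp add: distrib_right)
qed measurable

text \<open>Each term of degree at most \<open>n\<close> is a combination of vanishing moments, so
  the Taylor polynomial can be subtracted from the exponential without changing the Fourier
  integral.\<close>

lemma taylor_polynomial_integral:
  shows "integrable lborel (\<lambda>x. (\<Sum>j\<le>n. (\<i> * complex_of_real (- (x \<bullet> \<xi>))) ^ j / fact j) * f x)"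
    and "(LINT x|lborel. (\<Sum>j\<le>n. (\<i> * complex_of_real (- (x \<bullet> \<xi>))) ^ j / fact j) * f x) = 0"
proof -
  have i: "integrable lborel (\<lambda>x. (x \<bullet> \<xi>) ^ j *\<^sub>R f x)" if "j \<le> n" for j
  proof (rule Bochner_Integration.integrable_bound)
    show "integrable lborel (\<lambda>x. norm \<xi> ^ j *\<^sub>R (norm x ^ j *\<^sub>R f x))"
      using that by (intro integrable_scaleR_right integrable_norm_power_le) auto
    have "\<bar>x \<bullet> \<xi>\<bar> ^ j \<le> norm \<xi> ^ j * norm x ^ j" for x
      using power_mono[OF Cauchy_Schwarz_ineq2[of x \<xi>] abs_ge_zero, of j]
      by (simp add: power_mult_distrib mult.commute)
    from mult_right_mono[OF this norm_ge_zero]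
    show "AE x in lborel. norm ((x \<bullet> \<xi>) ^ j *\<^sub>R f x) \<le> norm (norm \<xi> ^ j *\<^sub>R (norm x ^ j *\<^sub>R f x))"
      by (intro AE_I2) (simp add: power_abs mult.assoc)
  qed measurable
  have p: "(\<i> * complex_of_real (- y)) ^ j = (- \<i>) ^ j * complex_of_real y ^ j" for y j
    by (simp add: power_mult_distrib[symmetric])
  have eq: "(\<lambda>x. (\<Sum>j\<le>n. (\<i> * complex_of_real (- (x \<bullet> \<xi>))) ^ j / fact j) * f x)
    = (\<lambda>x. \<Sum>j\<le>n. ((- \<i>) ^ j / fact j) * ((x \<bullet> \<xi>) ^ j *\<^sub>R f x))"
    unfolding sum_distrib_right
    by (simp only: p scaleR_conv_of_real of_real_power times_divide_eq_left mult.assoc)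
  have ii: "integrable lborel (\<lambda>x. ((- \<i>) ^ j / fact j) * ((x \<bullet> \<xi>) ^ j *\<^sub>R f x))" if "j \<le> n" for j
    using i[OF that] by (rule integrable_mult_right)
  then show "integrable lborel (\<lambda>x. (\<Sum>j\<le>n. (\<i> * complex_of_real (- (x \<bullet> \<xi>))) ^ j / fact j) * f x)"
    unfolding eq by (intro Bochner_Integration.integrable_sum) auto
  \<comment> \<open>Instance with the zero multi-index, for which \<open>mi_power\<close> is
    1.\<close>
  have "(LINT x|lborel. (x \<bullet> \<xi>) ^ j *\<^sub>R f x) = 0" if "j \<le> n" for j
    using inner_power_moment_eq_0[of "Suc n" f j "\<lambda>_. 0" \<xi>] integrable_norm_power_le vanish that
    by (simp add: mi_order_def mi_power_def)
  then have z: "(LINT x|lborel. ((- \<i>) ^ j / fact j) * ((x \<bullet> \<xi>) ^ j *\<^sub>R f x)) = 0" if "j \<le> n" for j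
    using that by (simp only: Bochner_Integration.integral_mult_right_zero mult_zero_right)
  have "(LINT x|lborel. (\<Sum>j\<le>n. ((- \<i>) ^ j / fact j) * ((x \<bullet> \<xi>) ^ j *\<^sub>R f x)))
    = (\<Sum>j\<le>n. (LINT x|lborel. ((- \<i>) ^ j / fact j) * ((x \<bullet> \<xi>) ^ j *\<^sub>R f x)))"
    by (intro Bochner_Integration.integral_sum ii) (simp only: atMost_iff)
  also have "\<dots> = 0"
    by (intro sum.neutral ballI z) (simp only: atMost_iff)
  finally show "(LINT x|lborel. (\<Sum>j\<le>n. (\<i> * complex_of_real (- (x \<bullet> \<xi>))) ^ j / fact j) * f x) = 0"
    unfolding eq .
qed

lemma fourier_integral_remainder:
  "(LINT x|lborel. cis (- (x \<bullet> \<xi>)) * f x)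
    = (LINT x|lborel. (iexp (- (x \<bullet> \<xi>)) - (\<Sum>j\<le>n. (\<i> * complex_of_real (- (x \<bullet> \<xi>))) ^ j / fact j)) * f x)"
proof -
  have "integrable lborel (\<lambda>x. iexp (- (x \<bullet> \<xi>)) * f x)"
    by (rule Bochner_Integration.integrable_bound[OF f]) (auto simp: norm_mult)
  then show ?thesis
    using taylor_polynomial_integral[of \<xi>]
    by (simp only: left_diff_distrib Bochner_Integration.integral_diff) (simp add: cis_conv_exp)
qed

text \<open>Only the Taylor remainder contributes, and it is at most |x . xi|^(n+1) / (n+1)!;
  Cauchy-Schwarz separates the variables and the factorial is dropped. The resulting zero at the
  origin compensates the singularity of |xi|^(-1-s).\<close>

lemma norm_fourier_integral_le:
  "norm (LINT x|lborel. cis (- (x \<bullet> \<xi>)) * f x) \<le> norm \<xi> ^ Suc n * (LINT x|lborel. norm x ^ Suc n * norm (f x))"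
proof -
  let ?R = "\<lambda>x. iexp (- (x \<bullet> \<xi>)) - (\<Sum>j\<le>n. (\<i> * complex_of_real (- (x \<bullet> \<xi>))) ^ j / fact j)"
  have le: "norm (?R x * f x) \<le> norm \<xi> ^ Suc n * (norm x ^ Suc n * norm (f x))" for x
  proof -
    have "norm (?R x) \<le> \<bar>- (x \<bullet> \<xi>)\<bar> ^ Suc n / fact (Suc n)"
      by (rule iexp_approx1)
    also have "\<dots> \<le> \<bar>- (x \<bullet> \<xi>)\<bar> ^ Suc n / 1"
      by (intro divide_left_mono fact_ge_1) auto
    also have "\<dots> \<le> (norm x * norm \<xi>) ^ Suc n"
      using power_mono[OF Cauchy_Schwarz_ineq2[of x \<xi>] abs_ge_zero, of "Suc n"] by simp
    finally have "norm (?R x) * norm (f x) \<le> (norm x * norm \<xi>) ^ Suc n * norm (f x)"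
      by (intro mult_right_mono) auto
    also have "\<dots> = norm \<xi> ^ Suc n * (norm x ^ Suc n * norm (f x))"
      by (simp add: power_mult_distrib)
    finally show ?thesis by (simp only: norm_mult)
  qed
  have i: "integrable lborel (\<lambda>x. norm \<xi> ^ Suc n * (norm x ^ Suc n * norm (f x)))"
    using fk by (rule integrable_mult_right)
  have "norm (LINT x|lborel. ?R x * f x) \<le> (LINT x|lborel. norm \<xi> ^ Suc n * (norm x ^ Suc n * norm (f x)))"
  proof (rule Bochner_Integration.integral_norm_bound_integral[OF _ i])
    show "integrable lborel (\<lambda>x. ?R x * f x)"
      by (rule Bochner_Integration.integrable_bound[OF i])
         (use le in \<open>auto simp: abs_mult intro!: AE_I2 simp del: power_Suc\<close>)
  qed (rule le)
  then show ?thesis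
    unfolding fourier_integral_remainder by simp
qed

text \<open>Dominated convergence. Continuity upgrades vanishing almost everywhere to vanishing
  everywhere in the next lemma.\<close>

lemma fourier_integral_continuous:
  "continuous_on UNIV (\<lambda>\<xi>. LINT x|lborel. cis (- (x \<bullet> \<xi>)) * f x)"
proof (rule continuous_at_imp_continuous_on, rule ballI, rule continuous_at_sequentiallyI)
  fix \<xi> :: "real ^ 'n" and u assume u: "u \<longlonglongrightarrow> \<xi>"
  show "(\<lambda>k. LINT x|lborel. cis (- (x \<bullet> u k)) * f x) \<longlonglongrightarrow> (LINT x|lborel. cis (- (x \<bullet> \<xi>)) * f x)"
  proof (rule integral_dominated_convergence[where w = "\<lambda>x. norm (f x)"])
    show "AE x in lborel. (\<lambda>k. cis (- (x \<bullet> u k)) * f x) \<longlonglongrightarrow> cis (- (x \<bullet> \<xi>)) * f x"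
      by (intro AE_I2 tendsto_intros u)
  qed (use f in \<open>auto simp: norm_mult\<close>)
qed

text \<open>Along the \<open>i\<close>-th coordinate axis the leading Taylor coefficient of the
  Fourier integral is a nonzero multiple of the moment of the pure power of \<open>x $ i\<close>. A
  vanishing transform would force that moment to vanish.\<close>

lemma fourier_not_AE_0:
  assumes "moment ((\<lambda>_. 0)(i := Suc n)) f \<noteq> 0"
  shows "\<not> (AE \<xi> in lborel. fourier f \<xi> = 0)"
proof
  assume AE0: "AE \<xi> in lborel. fourier f \<xi> = 0"
  let ?F = "\<lambda>\<xi>. LINT x|lborel. cis (- (x \<bullet> \<xi>)) * f x"
  let ?R = "\<lambda>u. iexp u - (\<Sum>j\<le>n. (\<i> * complex_of_real u) ^ j / fact j)"
  \<comment> \<open>The set where the integral is nonzero is open and null, hence empty.\<close>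
  have "open {\<xi>. ?F \<xi> \<noteq> 0}"
    using fourier_integral_continuous by (intro open_Collect_neq) auto
  moreover have "negligible {\<xi>. ?F \<xi> \<noteq> 0}"
    using AE_completion[OF AE0] calculation
    by (auto simp: negligible_iff_null_sets AE_iff_null_sets fourier_def)
  ultimately have F0: "?F \<xi> = 0" for \<xi>
    using open_not_negligible[of "{\<xi>. ?F \<xi> \<noteq> 0}"] by auto
  \<comment> \<open>Along \<open>\<xi> = e\<^sub>i / (m + 1)\<close> the leading Taylor term is the moment of \<open>x\<^sub>i^(n+1)\<close>.\<close>
  have "(\<lambda>m. LINT x|lborel. (of_nat (Suc m) ^ Suc n * ?R ((- (x $ i)) / real (Suc m))) * f x)
    \<longlonglongrightarrow> (LINT x|lborel. ((\<i> * complex_of_real (- (x $ i))) ^ Suc n / fact (Suc n)) * f x)"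
  proof (rule integral_dominated_convergence[where w = "\<lambda>x. norm x ^ Suc n * norm (f x)"])
    show "AE x in lborel. (\<lambda>m. (of_nat (Suc m) ^ Suc n * ?R ((- (x $ i)) / real (Suc m))) * f x)
      \<longlonglongrightarrow> ((\<i> * complex_of_real (- (x $ i))) ^ Suc n / fact (Suc n)) * f x"
      by (intro AE_I2 tendsto_mult tendsto_const iexp_scaled_remainder_tendsto)
    \<comment> \<open>The scaling factor cancels the power of m + 1 in the remainder bound, so the
      majorant is independent of \<open>m\<close>.\<close>
    show "AE x in lborel. norm ((of_nat (Suc m) ^ Suc n * ?R ((- (x $ i)) / real (Suc m))) * f x) \<le> norm x ^ Suc n * norm (f x)" for m
    proof (rule AE_I2)
      fix x :: "real ^ 'n"
      let ?M = "real (Suc m)" and ?u = "(- (x $ i)) / real (Suc m)"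
      have "norm (of_nat (Suc m) ^ Suc n * ?R ?u) = ?M ^ Suc n * norm (?R ?u)"
        by (simp only: norm_mult norm_power norm_of_nat)
      also have "\<dots> \<le> ?M ^ Suc n * (\<bar>?u\<bar> ^ Suc n / fact (Suc n))"
        by (intro mult_left_mono iexp_approx1) auto
      also have "\<dots> = \<bar>x $ i\<bar> ^ Suc n / fact (Suc n)"
        by (simp add: power_divide del: of_nat_Suc fact_Suc power_Suc)
      also have "\<dots> \<le> \<bar>x $ i\<bar> ^ Suc n / 1"
        by (intro divide_left_mono fact_ge_1) auto
      also have "\<dots> \<le> norm x ^ Suc n"
        using power_mono[OF component_le_norm_cart[of x i] abs_ge_zero, of "Suc n"] by simp
      finally show "norm ((of_nat (Suc m) ^ Suc n * ?R ?u) * f x) \<le> norm x ^ Suc n * norm (f x)"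
        unfolding norm_mult[of _ "f x"] by (intro mult_right_mono) auto
    qed
  qed (use fk in measurable)
  moreover have "(LINT x|lborel. (of_nat (Suc m) ^ Suc n * ?R ((- (x $ i)) / real (Suc m))) * f x) = 0" for m
  proof -
    have "x \<bullet> axis i (1 / real (Suc m)) = x $ i / real (Suc m)" for x :: "real ^ 'n"
      by (simp add: inner_axis)
    then have "(LINT x|lborel. ?R ((- (x $ i)) / real (Suc m)) * f x) = 0"
      using fourier_integral_remainder[of "axis i (1 / real (Suc m))"]
      unfolding F0 minus_divide_left by (simp only: minus_divide_left)
    then show ?thesis
      by (simp only: mult.assoc Bochner_Integration.integral_mult_right_zero mult_zero_right)
  qed
  ultimately have "(LINT x|lborel. ((\<i> * complex_of_real (- (x $ i))) ^ Suc n / fact (Suc n)) * f x) = 0"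
    by (simp only: LIMSEQ_const_iff)
  moreover have "mi_power x ((\<lambda>_. 0)(i := Suc n)) = (x $ i) ^ Suc n" for x :: "real ^ 'n"
    by (simp add: mi_power_def prod.remove[of UNIV i] del: power_Suc)
  then have "((\<i> * complex_of_real (- (x $ i))) ^ Suc n / fact (Suc n)) * f x
    = ((- \<i>) ^ Suc n / fact (Suc n)) * (mi_power x ((\<lambda>_. 0)(i := Suc n)) *\<^sub>R f x)" for x
    by (simp add: scaleR_conv_of_real power_mult_distrib[symmetric] del: power_Suc fact_Suc)
  ultimately have "((- \<i>) ^ Suc n / fact (Suc n)) * moment ((\<lambda>_. 0)(i := Suc n)) f = 0"
    unfolding moment_def by (simp only: Bochner_Integration.integral_mult_right_zero)
  then show False
    using assms by (simp del: power_Suc fact_Suc)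
qed

end

section \<open>The wave equation\<close>

lemma L2_norm_power2: "(L2_norm f)\<^sup>2 = (LINT x|lborel. (norm (f x))\<^sup>2)"
  unfolding L2_norm_def by simp

lemma L2_norm_nonneg: "L2_norm f \<ge> 0"
  unfolding L2_norm_def by simp

text \<open>The function is |xi|^(-1-s) times the transform of \<open>f\<close>, up to a null set.
  Inside the unit ball the zero of order \<open>Suc n\<close> absorbs the singularity; outside it
  the factor is at most 1 and the Plancherel inequality applies.\<close>

lemma weighted_fourier_in_L2:
  fixes f v :: "real ^ 'n \<Rightarrow> complex" and s :: real
  assumes s: "s \<ge> 0" and n: "real (Suc n) > 1 + s - real CARD('n) / 2"
    and f: "integrable lborel f" and f2: "in_L2 f"
    and fk: "integrable lborel (\<lambda>x. norm x ^ Suc n * norm (f x))"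
    and vanish: "\<And>\<alpha>. mi_order \<alpha> \<le> n \<Longrightarrow> moment \<alpha> f = 0"
    and v: "v \<in> borel_measurable borel" and nabla: "is_nabla s v f"
  shows "in_L2 (\<lambda>\<xi>. (1 / norm \<xi>) *\<^sub>R v \<xi>)"
    and "(L2_norm (\<lambda>\<xi>. (1 / norm \<xi>) *\<^sub>R v \<xi>))\<^sup>2
      \<le> (LINT \<xi>::real ^ 'n|lborel. indicator (cball 0 1) \<xi> * norm \<xi> powr (2 * (real (Suc n) - 1 - s)))
          * (LINT x|lborel. norm x ^ Suc n * norm (f x))\<^sup>2 + (L2_norm f)\<^sup>2"
proof -
  let ?b = "\<lambda>\<xi>. (1 / norm \<xi>) *\<^sub>R v \<xi>"
  let ?p = "2 * (real (Suc n) - 1 - s)"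
  let ?w = "\<lambda>\<xi>::real ^ 'n. indicator (cball 0 1) \<xi> * norm \<xi> powr ?p"
  let ?M = "LINT x|lborel. norm x ^ Suc n * norm (f x)"
  note [measurable] = v
  \<comment> \<open>The condition that \<open>?p\<close> exceeds minus the dimension is twice the
    hypothesis \<open>n\<close>.\<close>
  have w: "integrable lborel ?w"
    using n by (intro integrable_norm_powr_cball) simp
  have F: "integrable lborel (\<lambda>\<xi>. (norm (fourier f \<xi>))\<^sup>2)" and FL: "L2_norm (fourier f) \<le> L2_norm f"
    using fourier_in_L2[OF f f2] by (auto simp: in_L2_def)
  \<comment> \<open>A single majorant for both regions: the first summand suffices inside the unit
    ball and vanishes outside, where the second suffices.\<close>
  have i: "integrable lborel (\<lambda>\<xi>. ?w \<xi> * ?M\<^sup>2 + (norm (fourier f \<xi>))\<^sup>2)"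
    by (intro Bochner_Integration.integrable_add integrable_mult_left w F)
  have "AE \<xi> in lborel. \<xi> \<noteq> (0::real ^ 'n)"
    by (rule AE_lborel_singleton)
  with nabla[unfolded is_nabla_def]
  have le: "AE \<xi> in lborel. (norm (?b \<xi>))\<^sup>2 \<le> ?w \<xi> * ?M\<^sup>2 + (norm (fourier f \<xi>))\<^sup>2"
  proof eventually_elim
    case (elim \<xi>)
    let ?r = "norm \<xi>"
    have r: "?r > 0" using elim(2) by simp
    have "norm (fourier f \<xi>) = ?r powr s * norm (v \<xi>)"
      by (simp add: elim(1)[symmetric])
    then have "norm (?b \<xi>) = ?r powr (- 1 - s) * norm (fourier f \<xi>)"
      using r by (simp add: powr_diff powr_minus powr_add field_simps)
    then have b: "(norm (?b \<xi>))\<^sup>2 = (?r powr (- 1 - s))\<^sup>2 * (norm (fourier f \<xi>))\<^sup>2"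
      by (simp add: power_mult_distrib)
    show ?case
    proof (cases "?r \<le> 1")
      case True
      \<comment> \<open>The normalising constant of the Fourier transform is at most 1 and is
        dropped.\<close>
      have "(2 * pi) powr (- (real CARD('n) / 2)) \<le> 1"
        using pi_gt3 powr_mono[of "- (real CARD('n) / 2)" 0 "2 * pi"] by simp
      then have "norm (fourier f \<xi>) \<le> 1 * (?r ^ Suc n * ?M)"
        unfolding fourier_def norm_scaleR
        by (intro mult_mono norm_fourier_integral_le[OF f fk vanish]) auto
      then have "(norm (fourier f \<xi>))\<^sup>2 \<le> (?r powr real (Suc n))\<^sup>2 * ?M\<^sup>2"
        unfolding powr_realpow[OF r] power_mult_distrib[symmetric] by (intro power_mono) auto
      then have "(norm (?b \<xi>))\<^sup>2 \<le> (?r powr (- 1 - s))\<^sup>2 * ((?r powr real (Suc n))\<^sup>2 * ?M\<^sup>2)"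
        unfolding b by (intro mult_left_mono) auto
      also have "\<dots> = ?r powr ?p * ?M\<^sup>2"
      proof -
        have "(?r powr (- 1 - s))\<^sup>2 * (?r powr real (Suc n))\<^sup>2 = ?r powr ?p"
          unfolding power2_eq_square powr_add[symmetric] by (simp add: algebra_simps)
        then show ?thesis by (simp only: mult.assoc[symmetric])
      qed
      finally show ?thesis
        using True by (simp add: add_increasing2)
    next
      case False
      then have "(?r powr (- 1 - s))\<^sup>2 \<le> 1"
        using s r powr_mono[of "- 1 - s" 0 ?r] by (intro power_le_one) auto
      then have "(?r powr (- 1 - s))\<^sup>2 * (norm (fourier f \<xi>))\<^sup>2 \<le> 1 * (norm (fourier f \<xi>))\<^sup>2"
        by (intro mult_right_mono) auto
      then show ?thesis
        unfolding b using False by simp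
    qed
  qed
  have bi: "integrable lborel (\<lambda>\<xi>. (norm (?b \<xi>))\<^sup>2)"
    by (rule Bochner_Integration.integrable_bound[OF i]) (use le in \<open>auto elim: eventually_mono\<close>)
  then show "in_L2 ?b"
    by (simp add: in_L2_def)
  have "(L2_norm ?b)\<^sup>2 \<le> (LINT \<xi>|lborel. ?w \<xi> * ?M\<^sup>2 + (norm (fourier f \<xi>))\<^sup>2)"
    unfolding L2_norm_power2 by (intro integral_mono_AE bi i le)
  also have "\<dots> = (LINT \<xi>|lborel. ?w \<xi>) * ?M\<^sup>2 + (L2_norm (fourier f))\<^sup>2"
    unfolding L2_norm_power2 using w F by simp
  also have "\<dots> \<le> (LINT \<xi>|lborel. ?w \<xi>) * ?M\<^sup>2 + (L2_norm f)\<^sup>2"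
    using FL by (intro add_left_mono power_mono L2_norm_nonneg)
  finally show "(L2_norm ?b)\<^sup>2 \<le> (LINT \<xi>|lborel. ?w \<xi>) * ?M\<^sup>2 + (L2_norm f)\<^sup>2" .
qed

lemma in_L2_oscillation:
  fixes a b :: "real ^ 'n \<Rightarrow> complex" and t :: real
  assumes a: "in_L2 a" and b: "in_L2 b"
  defines "w \<equiv> \<lambda>\<xi>. cos (norm \<xi> * t) *\<^sub>R a \<xi> + sin (norm \<xi> * t) *\<^sub>R b \<xi>"
  shows "in_L2 w" and "(L2_norm w)\<^sup>2 \<le> 2 * (L2_norm a)\<^sup>2 + 2 * (L2_norm b)\<^sup>2"
proof -
  have [measurable]: "a \<in> borel_measurable borel" "b \<in> borel_measurable borel"
    using a b by (auto simp: in_L2_def)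
  have i: "integrable lborel (\<lambda>\<xi>. 2 * (norm (a \<xi>))\<^sup>2 + 2 * (norm (b \<xi>))\<^sup>2)"
    using a b by (auto simp: in_L2_def)
  have le: "(norm (w \<xi>))\<^sup>2 \<le> 2 * (norm (a \<xi>))\<^sup>2 + 2 * (norm (b \<xi>))\<^sup>2" for \<xi>
  proof -
    have "norm (w \<xi>) \<le> \<bar>cos (norm \<xi> * t)\<bar> * norm (a \<xi>) + \<bar>sin (norm \<xi> * t)\<bar> * norm (b \<xi>)"
      unfolding w_def by (rule order_trans[OF norm_triangle_ineq]) simp
    also have "\<dots> \<le> 1 * norm (a \<xi>) + 1 * norm (b \<xi>)"
      by (intro add_mono mult_right_mono) auto
    finally have "(norm (w \<xi>))\<^sup>2 \<le> (norm (a \<xi>) + norm (b \<xi>))\<^sup>2"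
      by (intro power_mono) auto
    then show ?thesis
      using sum_squares_bound[of "norm (a \<xi>)" "norm (b \<xi>)"] by (simp add: power2_sum)
  qed
  have [measurable]: "w \<in> borel_measurable borel"
    unfolding w_def by measurable
  have wi: "integrable lborel (\<lambda>\<xi>. (norm (w \<xi>))\<^sup>2)"
    by (rule Bochner_Integration.integrable_bound[OF i]) (use le in auto)
  then show "in_L2 w"
    by (simp add: in_L2_def)
  have "(L2_norm w)\<^sup>2 \<le> (LINT \<xi>|lborel. 2 * (norm (a \<xi>))\<^sup>2 + 2 * (norm (b \<xi>))\<^sup>2)"
    unfolding L2_norm_power2 by (intro integral_mono wi i le)
  also have "\<dots> = 2 * (L2_norm a)\<^sup>2 + 2 * (L2_norm b)\<^sup>2"
    unfolding L2_norm_power2 using a b by (simp add: in_L2_def)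
  finally show "(L2_norm w)\<^sup>2 \<le> 2 * (L2_norm a)\<^sup>2 + 2 * (L2_norm b)\<^sup>2" .
qed

text \<open>The squared norm tends to \<open>L\<close>, so it eventually exceeds L / 2. Positivity
  of \<open>L\<close> comes from \<open>b\<close> alone, whatever \<open>a\<close> is.\<close>

lemma eventually_L2_norm_oscillation_ge:
  fixes a b :: "real ^ 'n \<Rightarrow> complex"
  assumes a: "in_L2 a" and b: "in_L2 b" and nz: "\<not> (AE \<xi> in lborel. b \<xi> = 0)"
  shows "\<exists>\<delta>>0. \<forall>\<^sub>F t in at_top.
    \<delta> \<le> L2_norm (\<lambda>\<xi>. cos (norm \<xi> * t) *\<^sub>R a \<xi> + sin (norm \<xi> * t) *\<^sub>R b \<xi>)"
proof -
  let ?W = "\<lambda>t. L2_norm (\<lambda>\<xi>. cos (norm \<xi> * t) *\<^sub>R a \<xi> + sin (norm \<xi> * t) *\<^sub>R b \<xi>)"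
  define L where "L = ((L2_norm a)\<^sup>2 + (L2_norm b)\<^sup>2) / 2"
  have ab: "a \<in> borel_measurable borel" "b \<in> borel_measurable borel"
    "integrable lborel (\<lambda>x. (norm (a x))\<^sup>2)" "integrable lborel (\<lambda>x. (norm (b x))\<^sup>2)"
    using a b by (auto simp: in_L2_def)
  have "(L2_norm b)\<^sup>2 \<noteq> 0"
    using nz integral_nonneg_eq_0_iff_AE[OF ab(4)] unfolding L2_norm_power2 by auto
  then have L: "L > 0"
    by (simp add: L_def add_nonneg_pos)
  have "((\<lambda>t. (?W t)\<^sup>2) \<longlongrightarrow> L) at_top"
    unfolding L_def L2_norm_power2 by (rule oscillating_L2_limit[OF ab])
  then have "\<forall>\<^sub>F t in at_top. L / 2 < (?W t)\<^sup>2"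
    by (rule order_tendstoD) (use L in simp)
  then have "\<forall>\<^sub>F t in at_top. sqrt (L / 2) \<le> ?W t"
    by eventually_elim (rule real_le_lsqrt[OF L2_norm_nonneg less_imp_le])
  then show ?thesis
    using L by (intro exI[of _ "sqrt (L / 2)"]) auto
qed

section \<open>The two-sided estimate\<close>

theorem theorem2p3:
  fixes s \<kappa> :: real
  assumes "s \<ge> 0"
    and "real CARD('n::finite) \<le> 2 + 2 * s"
    and "\<kappa> \<ge> 0"
    and "real_of_int \<lfloor>\<kappa>\<rfloor> > 2 + s - real CARD('n) / 2"
  shows "\<exists>C>0. \<forall>(u0 :: real ^ 'n \<Rightarrow> complex) u0_hat
      (u1 :: (real ^ 'n \<Rightarrow> complex) \<Rightarrow> complex) u1_hat (nabla_u1 :: real ^ 'n \<Rightarrow> complex).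
    in_L2 u0 \<longrightarrow> fourier_L2 u0 u0_hat \<longrightarrow>
    tempered_distribution u1 \<longrightarrow> fourier_distribution u1 u1_hat \<longrightarrow>
    is_nabla s u1_hat nabla_u1 \<longrightarrow> in_L2 nabla_u1 \<longrightarrow> in_L1w \<kappa> nabla_u1 \<longrightarrow>
    (\<forall>\<alpha>. int (mi_order \<alpha>) < \<lfloor>\<kappa>\<rfloor> - 1 \<longrightarrow> moment \<alpha> nabla_u1 = 0) \<longrightarrow>
    (\<forall>\<alpha>. int (mi_order \<alpha>) = \<lfloor>\<kappa>\<rfloor> - 1 \<longrightarrow> moment \<alpha> nabla_u1 \<noteq> 0) \<longrightarrow>
    (\<exists>c>0. \<exists>T>0. \<forall>t\<ge>T.
       in_L2 (wave_hat u0_hat u1_hat t) \<and>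
       c * moments_norm (nat (\<lfloor>\<kappa>\<rfloor> - 1)) nabla_u1 \<le> L2_norm (wave_hat u0_hat u1_hat t) \<and>
       L2_norm (wave_hat u0_hat u1_hat t)
         \<le> C * (L2_norm u0 + (L2_norm nabla_u1 + L1w_norm \<kappa> nabla_u1)))"
proof -
  \<comment> \<open>Offset by 2: \<open>n\<close> is the highest order of the vanishing moments, so
    \<open>Suc n\<close> is the order k = floor kappa - 1 of the nonvanishing ones.\<close>
  define n where "n = nat (\<lfloor>\<kappa>\<rfloor> - 2)"
  let ?p = "2 * (real (Suc n) - 1 - s)"
  define I where "I = (LINT \<xi>::real ^ 'n|lborel. indicator (cball 0 1) \<xi> * norm \<xi> powr ?p)"
  \<comment> \<open>The 4 is the product of the factors 2 in \<open>in_L2_oscillation\<close> and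
    \<open>fourier_L2_norm_le\<close>; \<open>2 * I\<close> is the low-frequency part of the second
    term. Only the dimension, \<open>s\<close> and \<open>\<kappa>\<close> enter.\<close>
  define C where "C = sqrt (4 + 2 * I)"
  \<comment> \<open>The bound on the dimension gives 2 + s - CARD('n) / 2 \<ge> 1, so the floor is
    at least 2 and \<open>nat\<close> truncates nothing.\<close>
  have "real_of_int \<lfloor>\<kappa>\<rfloor> > 1"
    using assms(2,4) by linarith
  then have fl: "\<lfloor>\<kappa>\<rfloor> = int n + 2"
    unfolding n_def by simp
  have n: "real (Suc n) > 1 + s - real CARD('n) / 2"
    using assms(4) unfolding fl by simp
  have n\<kappa>: "real (Suc n) \<le> \<kappa>"
    using of_int_floor_le[of \<kappa>] unfolding fl by simp
  have I: "I \<ge> 0"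
    unfolding I_def by (intro Bochner_Integration.integral_nonneg) auto
  have C: "C > 0"
    unfolding C_def using I by simp
  show ?thesis
  proof (rule exI[of _ C], intro conjI C allI impI)
    fix a a_hat v f :: "real ^ 'n \<Rightarrow> complex" and u
    assume a: "in_L2 a" and ah: "fourier_L2 a a_hat"
      and v: "fourier_distribution u v" and nabla: "is_nabla s v f"
      and f2: "in_L2 f" and fw: "in_L1w \<kappa> f"
      and van: "\<forall>\<alpha>. int (mi_order \<alpha>) < \<lfloor>\<kappa>\<rfloor> - 1 \<longrightarrow> moment \<alpha> f = 0"
      and nonvan: "\<forall>\<alpha>. int (mi_order \<alpha>) = \<lfloor>\<kappa>\<rfloor> - 1 \<longrightarrow> moment \<alpha> f \<noteq> 0"
    let ?b = "\<lambda>\<xi>. (1 / norm \<xi>) *\<^sub>R v \<xi>"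
    let ?P = "moments_norm (nat (\<lfloor>\<kappa>\<rfloor> - 1)) f"
    define M where "M = (LINT x|lborel. norm x ^ Suc n * norm (f x))"
    have f: "integrable lborel f"
      and f\<kappa>: "integrable lborel (\<lambda>x. (1 + norm x) powr \<kappa> * norm (f x))"
      using fw by (auto simp: in_L1w_def)
    have [measurable]: "f \<in> borel_measurable borel" using f by auto
    have vm: "v \<in> borel_measurable borel"
      using v by (simp add: fourier_distribution_def)
    have ah2: "in_L2 a_hat"
      using ah by (simp add: fourier_L2_def)
    have "norm x ^ Suc n \<le> (1 + norm x) powr \<kappa>" for x :: "real ^ 'n"
    proof -
      have "norm x ^ Suc n \<le> (1 + norm x) ^ Suc n"
        by (intro power_mono) auto
      also have "\<dots> = (1 + norm x) powr real (Suc n)"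
        by (rule powr_realpow[symmetric]) (simp add: add_pos_nonneg)
      also have "\<dots> \<le> (1 + norm x) powr \<kappa>"
        using n\<kappa> by (intro powr_mono) auto
      finally show ?thesis .
    qed
    then have le: "norm x ^ Suc n * norm (f x) \<le> (1 + norm x) powr \<kappa> * norm (f x)" for x
      by (intro mult_right_mono) auto
    have fk: "integrable lborel (\<lambda>x. norm x ^ Suc n * norm (f x))"
      by (rule Bochner_Integration.integrable_bound[OF f\<kappa>]) (use le in \<open>auto simp del: power_Suc\<close>)
    have M: "0 \<le> M" "M \<le> L1w_norm \<kappa> f"
      unfolding M_def L1w_norm_def
      by (intro Bochner_Integration.integral_nonneg, simp) (intro integral_mono fk f\<kappa> le)
    have vanish: "moment \<alpha> f = 0" if "mi_order \<alpha> \<le> n" for \<alpha>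
      using van that unfolding fl by simp
    note b = weighted_fourier_in_L2[OF assms(1) n f f2 fk vanish vm nabla, folded M_def I_def]
    \<comment> \<open>Moving 1 / |xi| from the sine to \<open>v\<close> puts the solution into the
      form treated by the oscillation lemmas.\<close>
    have wave: "wave_hat a_hat v t = (\<lambda>\<xi>. cos (norm \<xi> * t) *\<^sub>R a_hat \<xi> + sin (norm \<xi> * t) *\<^sub>R ?b \<xi>)" for t
      by (simp add: wave_hat_def fun_eq_iff)
    note w = in_L2_oscillation[OF ah2 b(1), folded wave]
    have upper: "L2_norm (wave_hat a_hat v t) \<le> C * (L2_norm a + (L2_norm f + L1w_norm \<kappa> f))" for t
    proof -
      define S where "S = L2_norm a + (L2_norm f + L1w_norm \<kappa> f)"
      have S: "L2_norm a \<le> S" "L2_norm f \<le> S" "M \<le> S" "0 \<le> S"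
        unfolding S_def using L2_norm_nonneg[of a] L2_norm_nonneg[of f] M by auto
      \<comment> \<open>The two squares are estimated together, so that one coefficient 4 covers
        four times the first and twice the second.\<close>
      have sq: "(L2_norm a)\<^sup>2 + (L2_norm f)\<^sup>2 \<le> S\<^sup>2"
      proof -
        have "(L2_norm a)\<^sup>2 + (L2_norm f)\<^sup>2 \<le> (L2_norm a + L2_norm f)\<^sup>2"
          using L2_norm_nonneg[of a] L2_norm_nonneg[of f] by (simp add: power2_sum)
        also have "\<dots> \<le> S\<^sup>2"
          using L2_norm_nonneg[of a] L2_norm_nonneg[of f] M unfolding S_def by (intro power_mono) auto
        finally show ?thesis .
      qed
      have "(L2_norm (wave_hat a_hat v t))\<^sup>2 \<le> 2 * (L2_norm a_hat)\<^sup>2 + 2 * (L2_norm ?b)\<^sup>2"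
        by (rule w(2))
      also have "\<dots> \<le> 2 * (2 * (L2_norm a)\<^sup>2) + 2 * (I * M\<^sup>2 + (L2_norm f)\<^sup>2)"
        by (intro add_mono mult_left_mono fourier_L2_norm_le[OF a ah] b(2)) auto
      also have "\<dots> \<le> 4 * S\<^sup>2 + 2 * (I * S\<^sup>2)"
      proof -
        have "I * M\<^sup>2 \<le> I * S\<^sup>2"
          using S M I by (intro mult_left_mono power_mono) auto
        moreover have "2 * (2 * x) + 2 * (y + z) \<le> 4 * u + 2 * w"
          if "y \<le> w" "0 \<le> z" "x + z \<le> u" for x y z u w :: real
          using that by simp
        ultimately show ?thesis
          using sq zero_le_power2 by blast
      qed
      also have "\<dots> = (C * S)\<^sup>2"
      proof -
        have "C\<^sup>2 = 4 + 2 * I"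
          unfolding C_def using I by simp
        then show ?thesis
          by (simp add: power_mult_distrib distrib_right)
      qed
      finally have "(L2_norm (wave_hat a_hat v t))\<^sup>2 \<le> (C * S)\<^sup>2" .
      moreover have "0 \<le> C * S"
        using C S(4) by simp
      ultimately have "L2_norm (wave_hat a_hat v t) \<le> C * S"
        by (rule power2_le_imp_le)
      then show ?thesis
        unfolding S_def .
    qed
    \<comment> \<open>All moments of order \<open>Suc n\<close> are nonzero by hypothesis, so any
      coordinate will do; \<open>undefined\<close> names one.\<close>
    have "moment ((\<lambda>_. 0)(undefined := Suc n)) f \<noteq> 0"
      using nonvan unfolding fl by (simp add: mi_order_def sum.remove[of UNIV undefined])
    then have "\<not> (AE \<xi> in lborel. fourier f \<xi> = 0)"
      using fourier_not_AE_0[OF f fk] vanish by blast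
    \<comment> \<open>If \<open>?b\<close> vanished almost everywhere, so would \<open>v\<close>,
      and with it |xi|^s \<open>v\<close>, which is the transform of \<open>f\<close>.\<close>
    moreover have "AE \<xi> in lborel. fourier f \<xi> = 0" if "AE \<xi> in lborel. ?b \<xi> = 0"
    proof -
      have "AE \<xi> in lborel. \<xi> \<noteq> (0::real ^ 'n)"
        by (rule AE_lborel_singleton)
      with that nabla[unfolded is_nabla_def] show ?thesis
      proof eventually_elim
        case (elim \<xi>)
        then have "v \<xi> = 0" by simp
        with elim(2) show ?case by simp
      qed
    qed
    ultimately obtain \<delta> where \<delta>: "\<delta> > 0" "\<forall>\<^sub>F t in at_top. \<delta> \<le> L2_norm (wave_hat a_hat v t)"
      using eventually_L2_norm_oscillation_ge[OF ah2 b(1), folded wave] by blast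
    then obtain T where T: "\<And>t. t \<ge> T \<Longrightarrow> \<delta> \<le> L2_norm (wave_hat a_hat v t)"
      by (auto simp: eventually_at_top_linorder)
    have P: "0 \<le> ?P"
      unfolding moments_norm_def by (intro real_sqrt_ge_zero sum_nonneg) simp
    \<comment> \<open>The denominator is positive since ?P \<ge> 0, and ?P / (?P + 1) \<le> 1 yields
      the bound by \<open>\<delta>\<close>.\<close>
    define c where "c = \<delta> / (?P + 1)"
    have c: "c > 0" "c * ?P \<le> \<delta>"
      using P \<delta>(1) by (simp_all add: c_def field_simps)
    with T have lower: "c * ?P \<le> L2_norm (wave_hat a_hat v t)" if "t \<ge> T" for t
      using that by (meson order_trans)
    show "\<exists>c>0. \<exists>T>0. \<forall>t\<ge>T.
       in_L2 (wave_hat a_hat v t) \<and>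
       c * ?P \<le> L2_norm (wave_hat a_hat v t) \<and>
       L2_norm (wave_hat a_hat v t) \<le> C * (L2_norm a + (L2_norm f + L1w_norm \<kappa> f))"
      \<comment> \<open>\<open>max T 1\<close> makes the time positive, as \<open>T\<close> may be
        any real number.\<close>
      by (rule exI[of _ c], intro conjI c, rule exI[of _ "max T 1"], intro conjI allI impI)
         (auto intro: w(1) upper lower)
  qed
qed

end
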